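(* For all reals $\lambda>0$ and all integers $d\ge1$, $k\ge1$, asymptotically as $t$ tends to $\infty$, we have \[ \sigma^2(t) = \Theta(t^d), \] i.e., there exist constants $0<c\le C<\infty$ and $t_0>0$ (depending on $\lambda,d,k$) such that $c\,t^d\le\sigma^2(t)\le C\,t^d$ for all $t\ge t_0$.
   Context: For $V \subseteq \mathbb{R}^d$ and $r>0$, $G_r(V)$ is the graph with vertex set $V$ in which two distinct points $u,v\in V$ are adjacent if and only if $\|u-v\|\le r$ (Euclidean norm). For $k \in \mathbb{N}=\{1,2,\dots\}$ and finite $V$, $N_{k,r}(V)$ is the maximum number of vertices of $G_r(V)$ that can be properly colored with $k$ colors, i.e., the largest cardinality of a subset $U\subseteq V$ such that the induced subgraph $G_r(U)$ is $k$-colorable. $\mathcal{X}_\lambda$ is a Poisson point process of (constant) intensity $\lambda$ in $\mathbb{R}^d$, $F_{k,\lambda}(t) = N_{k,1}([0,t]^d \cap \mathcal{X}_\lambda)$, and $\sigma^2(t)=\mathrm{Var}\{F_{k,\lambda}(t)\}$. *)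

theory Defs
  imports "HOL-Probability.Probability"
begin

type_synonym 'a graph = "'a set \<times> 'a set set"

text \<open>Edges are two-element subsets of the vertex set.\<close>

definition geometric_graph :: "real \<Rightarrow> 'a::euclidean_space set \<Rightarrow> 'a graph" where
  "geometric_graph r V = (V, {{u, v} | u v. u \<in> V \<and> v \<in> V \<and> u \<noteq> v \<and> norm (u - v) \<le> r})"

definition k_colorable :: "nat \<Rightarrow> 'a graph \<Rightarrow> bool" where
  "k_colorable k G \<longleftrightarrow>
     (\<exists>c :: 'a \<Rightarrow> nat. (\<forall>v \<in> fst G. c v < k) \<and> (\<forall>u v. {u, v} \<in> snd G \<longrightarrow> c u \<noteq> c v))"

text \<open>Only meaningful for finite \<open>V\<close>. The induced subgraph of \<open>geometric_graph r V\<close> on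
  \<open>U \<subseteq> V\<close> is \<open>geometric_graph r U\<close>.\<close>

definition max_colorable :: "nat \<Rightarrow> real \<Rightarrow> 'a::euclidean_space set \<Rightarrow> nat" where
  "max_colorable k r V = Max (card ` {U. U \<subseteq> V \<and> k_colorable k (geometric_graph r U)})"

text \<open>A homogeneous Poisson process as a locally finite random set. Being a point process of
  diffuse intensity it is almost surely simple, so nothing is lost by using sets instead of
  counting measures. The law of the counts is written out because \<open>poisson_pmf\<close> is
  unspecified at rate \<open>0\<close>, which occurs for Lebesgue null sets.\<close>

definition poisson_process ::
    "'w measure \<Rightarrow> real \<Rightarrow> ('w \<Rightarrow> 'a::euclidean_space set) \<Rightarrow> bool" where
  "poisson_process M intensity X \<longleftrightarrow>
     prob_space M \<and>
     (\<forall>\<omega> \<in> space M. \<forall>B. bounded B \<longrightarrow> finite (X \<omega> \<inter> B)) \<and>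
     (\<forall>B \<in> sets borel. bounded B \<longrightarrow>
        (\<lambda>\<omega>. card (X \<omega> \<inter> B)) \<in> measurable M (count_space UNIV) \<and>
        (\<forall>n. measure M {\<omega> \<in> space M. card (X \<omega> \<inter> B) = n} =
             (intensity * measure lborel B) ^ n / fact n * exp (- (intensity * measure lborel B)))) \<and>
     (\<forall>(I :: nat set) B. finite I \<and> disjoint_family_on B I \<and>
          (\<forall>i \<in> I. B i \<in> sets borel \<and> bounded (B i)) \<longrightarrow>
        prob_space.indep_vars M (\<lambda>_. count_space UNIV) (\<lambda>i \<omega>. card (X \<omega> \<inter> B i)) I)"

definition F :: "nat \<Rightarrow> ('w \<Rightarrow> (real ^ 'n) set) \<Rightarrow> real \<Rightarrow> 'w \<Rightarrow> real" where
  "F k X t \<omega> = real (max_colorable k 1 (cbox 0 (vec t) \<inter> X \<omega>))"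

definition sigma_squared :: "'w measure \<Rightarrow> nat \<Rightarrow> ('w \<Rightarrow> (real ^ 'n) set) \<Rightarrow> real \<Rightarrow> real" where
  "sigma_squared M k X t = prob_space.variance M (F k X t)"

end

(* By independence, the pattern of occupied cells of a fine grid is a family of independent
   Bernoulli bits, and since the points are locally finite, the discretised colouring number agrees
   with the true one as soon as the grid is fine enough.  This yields measurability.

   Upper bound: switching one bit changes the colouring number by at most 1, so by tensorisation of
   the variance the sum of the bit probabilities, at most lambda * t^d, bounds the variance.

   Lower bound: place of order t^d disjoint cubes in the window, each with a core at distance greater
   than 1 from the outside of the cube.  If the moat between core and boundary is empty, the core
   contributes to the colouring number independently of everything else.  The score of a cube, the
   centred indicator that the core is occupied, switched off when the moat is occupied, therefore
   correlates with the colouring number by at least its own variance v.  As distinct scores are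
   uncorrelated, the colouring number has variance at least (number of cubes) * v. *)

theory Submission
  imports Defs
begin

section \<open>Colourable subsets of geometric graphs\<close>

lemma k_colorable_geometric_iff:
  "k_colorable k (geometric_graph r U) \<longleftrightarrow>
     (\<exists>c. (\<forall>v\<in>U. c v < k) \<and> (\<forall>u\<in>U. \<forall>v\<in>U. u \<noteq> v \<and> norm (u - v) \<le> r \<longrightarrow> c u \<noteq> c v))"
proof -
  have "{u, v} \<in> snd (geometric_graph r U) \<longleftrightarrow> u \<in> U \<and> v \<in> U \<and> u \<noteq> v \<and> norm (u - v) \<le> r" for u v
    unfolding geometric_graph_def by (auto simp: doubleton_eq_iff norm_minus_commute)
  moreover have "fst (geometric_graph r U) = U"
    by (simp add: geometric_graph_def)
  ultimately show ?thesis
    unfolding k_colorable_def by auto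
qed

lemma k_colorable_subset:
  "k_colorable k (geometric_graph r U) \<Longrightarrow> U' \<subseteq> U \<Longrightarrow> k_colorable k (geometric_graph r U')"
  unfolding k_colorable_geometric_iff by (erule ex_forward) blast

lemma card_le_max_colorable:
  assumes "finite V" "U \<subseteq> V" "k_colorable k (geometric_graph r U)"
  shows "card U \<le> max_colorable k r V"
  unfolding max_colorable_def using assms by (intro Max_ge) auto

text \<open>The empty set is always colourable, so the maximum runs over a nonempty finite set of
  cardinalities and is attained.\<close>

lemma max_colorable_witness:
  assumes "finite V"
  obtains U where "U \<subseteq> V" "k_colorable k (geometric_graph r U)" "card U = max_colorable k r V"
proof -
  have "k_colorable k (geometric_graph r {})"
    by (simp add: k_colorable_geometric_iff)
  then have "max_colorable k r V \<in> card ` {U. U \<subseteq> V \<and> k_colorable k (geometric_graph r U)}"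
    unfolding max_colorable_def using assms by (intro Max_in) auto
  then show ?thesis using that by auto
qed

lemma max_colorable_mono:
  assumes "finite V'" "V \<subseteq> V'"
  shows "max_colorable k r V \<le> max_colorable k r V'"
proof -
  obtain U where "U \<subseteq> V" "k_colorable k (geometric_graph r U)" "card U = max_colorable k r V"
    using max_colorable_witness[of V] assms finite_subset by blast
  then show ?thesis
    using card_le_max_colorable[of V' U k r] assms by auto
qed

text \<open>Removing \<open>x\<close> from an optimal subset of the larger set leaves a colourable
  subset of \<open>V\<close>. This bounded-difference property drives the upper variance
  bound.\<close>

lemma max_colorable_insert_le:
  assumes "finite V"
  shows "max_colorable k r (insert x V) \<le> max_colorable k r V + 1"
proof -
  obtain U where U: "U \<subseteq> insert x V" "k_colorable k (geometric_graph r U)"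
      "card U = max_colorable k r (insert x V)"
    using max_colorable_witness[of "insert x V"] assms by blast
  have "card (U - {x}) \<le> max_colorable k r V"
    using U assms by (intro card_le_max_colorable) (auto intro: k_colorable_subset)
  then show ?thesis
    using U(3) card_Suc_Diff1[of U x] finite_subset[OF U(1)] assms
    by (cases "x \<in> U") auto
qed

lemma max_colorable_ge_1:
  assumes "finite V" "V \<noteq> {}" "k \<ge> 1"
  shows "max_colorable k r V \<ge> 1"
proof -
  obtain x where "x \<in> V" using assms by blast
  moreover have "k_colorable k (geometric_graph r {x})"
    unfolding k_colorable_geometric_iff using \<open>k \<ge> 1\<close> by (intro exI[of _ "\<lambda>_. 0"]) auto
  ultimately have "card {x} \<le> max_colorable k r V"
    using assms by (intro card_le_max_colorable) auto
  then show ?thesis by simp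
qed

text \<open>No edge joins \<open>V\<close> to \<open>V'\<close>: an optimal subset of the union
  splits into two colourable parts, and optimal colourings of the two sides glue together.\<close>

lemma max_colorable_Un_far:
  assumes fin: "finite V" "finite V'"
    and far: "\<And>u v. u \<in> V \<Longrightarrow> v \<in> V' \<Longrightarrow> norm (u - v) > r" and "0 \<le> r"
  shows "max_colorable k r (V \<union> V') = max_colorable k r V + max_colorable k r V'"
proof (rule antisym)
  \<comment> \<open>Since \<open>0 \<le> r\<close>, a common point would be at distance 0 from
    itself and violate \<open>far\<close>.\<close>
  have disj: "V \<inter> V' = {}"
    using far \<open>0 \<le> r\<close> by fastforce
  obtain U where U: "U \<subseteq> V \<union> V'" "k_colorable k (geometric_graph r U)"
      "card U = max_colorable k r (V \<union> V')"
    using max_colorable_witness[of "V \<union> V'"] fin by blast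
  have "card U = card (U \<inter> V) + card (U \<inter> V')"
    using U(1) disj fin by (subst card_Un_disjoint[symmetric]) (auto intro: arg_cong[where f = card])
  also have "\<dots> \<le> max_colorable k r V + max_colorable k r V'"
    using U(2) fin by (intro add_mono card_le_max_colorable) (auto intro: k_colorable_subset)
  finally show "max_colorable k r (V \<union> V') \<le> max_colorable k r V + max_colorable k r V'"
    using U(3) by simp
  obtain U where U: "U \<subseteq> V" "k_colorable k (geometric_graph r U)" "card U = max_colorable k r V"
    using max_colorable_witness[of V] fin by blast
  obtain U' where U': "U' \<subseteq> V'" "k_colorable k (geometric_graph r U')"
      "card U' = max_colorable k r V'"
    using max_colorable_witness[of V'] fin by blast
  obtain c where c: "\<forall>v\<in>U. c v < k" "\<forall>u\<in>U. \<forall>v\<in>U. u \<noteq> v \<and> norm (u - v) \<le> r \<longrightarrow> c u \<noteq> c v"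
    using U(2) unfolding k_colorable_geometric_iff by blast
  obtain c' where c': "\<forall>v\<in>U'. c' v < k"
      "\<forall>u\<in>U'. \<forall>v\<in>U'. u \<noteq> v \<and> norm (u - v) \<le> r \<longrightarrow> c' u \<noteq> c' v"
    using U'(2) unfolding k_colorable_geometric_iff by blast
  have far': "\<not> norm (u - v) \<le> r" "\<not> norm (v - u) \<le> r" if "u \<in> U" "v \<in> U'" for u v
    using far[OF subsetD[OF U(1) that(1)] subsetD[OF U'(1) that(2)]]
    by (simp_all add: norm_minus_commute)
  have "k_colorable k (geometric_graph r (U \<union> U'))"
    unfolding k_colorable_geometric_iff
  proof (intro exI[of _ "\<lambda>v. if v \<in> U then c v else c' v"] conjI ballI impI)
    have "U' \<inter> U = {}" using U(1) U'(1) disj by blast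
    then show "(if v \<in> U then c v else c' v) < k" if "v \<in> U \<union> U'" for v
      using that c(1) c'(1) by auto
    fix u v assume *: "u \<in> U \<union> U'" "v \<in> U \<union> U'" "u \<noteq> v \<and> norm (u - v) \<le> r"
    then show "(if u \<in> U then c u else c' u) \<noteq> (if v \<in> U then c v else c' v)"
      using c(2) c'(2) far'[of u v] far'[of v u] by auto
  qed
  then have "card (U \<union> U') \<le> max_colorable k r (V \<union> V')"
    using U(1) U'(1) fin by (intro card_le_max_colorable) auto
  moreover have "card (U \<union> U') = card U + card U'"
    using U(1) U'(1) fin disj by (intro card_Un_disjoint) (auto intro: finite_subset)
  ultimately show "max_colorable k r V + max_colorable k r V' \<le> max_colorable k r (V \<union> V')"
    using U(3) U'(3) by simp
qed

text \<open>A colourable set meets each \<open>Q j\<close> in a clique, on which the colouring is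
  injective, so in at most \<open>k\<close> points. The bound depends on the cover alone, however
  many points there are.\<close>

lemma max_colorable_le_cover:
  assumes "finite V" "finite J" "V \<subseteq> (\<Union>j\<in>J. Q j)"
    and diam: "\<And>j u v. j \<in> J \<Longrightarrow> u \<in> Q j \<Longrightarrow> v \<in> Q j \<Longrightarrow> norm (u - v) \<le> r"
  shows "max_colorable k r V \<le> card J * k"
proof -
  obtain U where U: "U \<subseteq> V" "k_colorable k (geometric_graph r U)" "card U = max_colorable k r V"
    using max_colorable_witness[of V] assms by blast
  obtain c where c: "\<forall>v\<in>U. c v < k" "\<forall>u\<in>U. \<forall>v\<in>U. u \<noteq> v \<and> norm (u - v) \<le> r \<longrightarrow> c u \<noteq> c v"
    using U(2) unfolding k_colorable_geometric_iff by blast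
  have "card (U \<inter> Q j) \<le> k" if "j \<in> J" for j
  proof -
    have "inj_on c (U \<inter> Q j)"
      using c(2) diam[OF that] by (auto simp: inj_on_def)
    then have "card (U \<inter> Q j) \<le> card {..<k}"
      using c(1) by (intro card_inj_on_le[of c]) auto
    then show ?thesis by simp
  qed
  then have "(\<Sum>j\<in>J. card (U \<inter> Q j)) \<le> card J * k"
    using sum_bounded_above[of J "\<lambda>j. card (U \<inter> Q j)" k] by simp
  moreover have "card U \<le> (\<Sum>j\<in>J. card (U \<inter> Q j))"
  proof -
    have "U = (\<Union>j\<in>J. U \<inter> Q j)" using U(1) assms(3) by blast
    then show ?thesis using card_UN_le[OF assms(2), of "\<lambda>j. U \<inter> Q j"] by simp
  qed
  ultimately show ?thesis using U(3) by simp
qed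

text \<open>\<open>f\<close> is an isomorphism between the two geometric graphs, so colourings
  transfer along \<open>f\<close> and its inverse. Two radii are allowed because rounding the points
  goes with enlarging the radius.\<close>

lemma max_colorable_image:
  assumes "inj_on f V"
    and adj: "\<And>u v. u \<in> V \<Longrightarrow> v \<in> V \<Longrightarrow> u \<noteq> v \<Longrightarrow> norm (f u - f v) \<le> s \<longleftrightarrow> norm (u - v) \<le> r"
  shows "max_colorable k s (f ` V) = max_colorable k r V"
proof -
  have col: "k_colorable k (geometric_graph s (f ` U)) \<longleftrightarrow> k_colorable k (geometric_graph r U)"
    if "U \<subseteq> V" for U
  proof
    have inj: "inj_on f U" using assms(1) that inj_on_subset by blast
    assume "k_colorable k (geometric_graph s (f ` U))"
    then obtain c where c: "\<forall>v\<in>f ` U. c v < k"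
      "\<forall>u\<in>f ` U. \<forall>v\<in>f ` U. u \<noteq> v \<and> norm (u - v) \<le> s \<longrightarrow> c u \<noteq> c v"
      unfolding k_colorable_geometric_iff by blast
    have "\<forall>u\<in>U. \<forall>v\<in>U. u \<noteq> v \<and> norm (u - v) \<le> r \<longrightarrow> c (f u) \<noteq> c (f v)"
      using c(2) adj that inj unfolding inj_on_def by (metis imageI subsetD)
    then show "k_colorable k (geometric_graph r U)"
      unfolding k_colorable_geometric_iff using c(1) by (intro exI[of _ "c \<circ> f"]) auto
  next
    have inj: "inj_on f U" using assms(1) that inj_on_subset by blast
    assume "k_colorable k (geometric_graph r U)"
    then obtain c where c: "\<forall>v\<in>U. c v < k"
      "\<forall>u\<in>U. \<forall>v\<in>U. u \<noteq> v \<and> norm (u - v) \<le> r \<longrightarrow> c u \<noteq> c v"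
      unfolding k_colorable_geometric_iff by blast
    have "\<forall>u\<in>U. \<forall>v\<in>U. f u \<noteq> f v \<and> norm (f u - f v) \<le> s \<longrightarrow> c u \<noteq> c v"
      using c(2) adj that by (metis subsetD)
    then show "k_colorable k (geometric_graph s (f ` U))"
      unfolding k_colorable_geometric_iff using c(1) inj
      by (intro exI[of _ "c \<circ> the_inv_into U f"]) (auto simp: the_inv_into_f_f)
  qed
  have "{W. W \<subseteq> f ` V \<and> k_colorable k (geometric_graph s W)} =
        (`) f ` {U. U \<subseteq> V \<and> k_colorable k (geometric_graph r U)}"
    using col by (auto simp: subset_image_iff)
  moreover have "card (f ` U) = card U" if "U \<subseteq> V" for U
    using assms(1) that by (meson card_image inj_on_subset)
  ultimately show ?thesis
    unfolding max_colorable_def by (simp add: image_image cong: image_cong_simp)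
qed

section \<open>Functions of independent Bernoulli bits and tensorisation of the variance\<close>

text \<open>Expectation of a function of a random subset of \<open>C\<close> that contains each \<open>c\<close>
  independently with probability \<open>p c\<close>.\<close>

definition bernoulli_expect :: "'c set \<Rightarrow> ('c \<Rightarrow> real) \<Rightarrow> ('c set \<Rightarrow> real) \<Rightarrow> real" where
  "bernoulli_expect C p f = (\<Sum>S\<in>Pow C. f S * (\<Prod>c\<in>C. if c \<in> S then p c else 1 - p c))"

lemma bernoulli_expect_empty [simp]: "bernoulli_expect {} p f = f {}"
  by (simp add: bernoulli_expect_def)

text \<open>Conditioning on the bit of \<open>c\<close>: the subsets of \<open>insert c C\<close>
  are split by whether they contain \<open>c\<close>. Inductions over \<open>C\<close> rest on this
  recursion.\<close>

lemma bernoulli_expect_insert: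
  assumes "finite C" "c \<notin> C"
  shows "bernoulli_expect (insert c C) p f =
    bernoulli_expect C p (\<lambda>S. p c * f (insert c S) + (1 - p c) * f S)"
proof -
  define w where "w A S = (\<Prod>b\<in>A. if b \<in> S then p b else 1 - p b)" for A S
  have w0: "w (insert c C) S = (1 - p c) * w C S" if "S \<in> Pow C" for S
    using assms that unfolding w_def by (subst prod.insert) auto
  have w1: "w (insert c C) (insert c S) = p c * w C S" if "S \<in> Pow C" for S
    using assms that unfolding w_def
    by (subst prod.insert) (auto intro!: prod.cong)
  have "bernoulli_expect (insert c C) p f =
      (\<Sum>S\<in>Pow C. f S * w (insert c C) S) + (\<Sum>S\<in>insert c ` Pow C. f S * w (insert c C) S)"
    unfolding bernoulli_expect_def w_def[symmetric] Pow_insert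
    using assms by (intro sum.union_disjoint) auto
  also have "(\<Sum>S\<in>insert c ` Pow C. f S * w (insert c C) S) =
      (\<Sum>S\<in>Pow C. f (insert c S) * w (insert c C) (insert c S))"
    using assms(2) by (subst sum.reindex) (auto simp: inj_on_def)
  also have "(\<Sum>S\<in>Pow C. f S * w (insert c C) S) + \<dots> =
      bernoulli_expect C p (\<lambda>S. p c * f (insert c S) + (1 - p c) * f S)"
    unfolding bernoulli_expect_def w_def[symmetric] sum.distrib[symmetric]
    by (intro sum.cong refl) (simp only: w0 w1, simp add: algebra_simps)
  finally show ?thesis .
qed

lemma bernoulli_expect_cong:
  "(\<And>S. S \<subseteq> C \<Longrightarrow> f S = g S) \<Longrightarrow> bernoulli_expect C p f = bernoulli_expect C p g"
  unfolding bernoulli_expect_def by (intro sum.cong) auto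

lemma bernoulli_expect_add:
  "bernoulli_expect C p (\<lambda>S. f S + g S) = bernoulli_expect C p f + bernoulli_expect C p g"
  unfolding bernoulli_expect_def by (simp add: sum.distrib algebra_simps)

lemma bernoulli_expect_const:
  "finite C \<Longrightarrow> bernoulli_expect C p (\<lambda>_. x) = x"
  by (induction C rule: finite_induct) (simp_all add: bernoulli_expect_insert algebra_simps)

lemma bernoulli_expect_mono:
  assumes "\<And>c. c \<in> C \<Longrightarrow> 0 \<le> p c \<and> p c \<le> 1" "\<And>S. S \<subseteq> C \<Longrightarrow> f S \<le> g S"
  shows "bernoulli_expect C p f \<le> bernoulli_expect C p g"
  unfolding bernoulli_expect_def using assms
  by (intro sum_mono mult_right_mono prod_nonneg) auto

text \<open>Induction on \<open>C\<close>: the variance is the mean conditional variance given all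
  other bits plus the variance of the conditional mean. The conditional variance is
  \<open>p c * (1 - p c)\<close> times a squared difference, hence at most \<open>p c\<close>; the
  second term is bounded by the induction hypothesis.\<close>

lemma bernoulli_variance_le:
  assumes "finite C" "\<And>c. c \<in> C \<Longrightarrow> 0 \<le> p c \<and> p c \<le> 1"
    and "\<And>c S. c \<in> C \<Longrightarrow> S \<subseteq> C \<Longrightarrow> \<bar>f (insert c S) - f S\<bar> \<le> 1"
  shows "bernoulli_expect C p (\<lambda>S. (f S)\<^sup>2) - (bernoulli_expect C p f)\<^sup>2 \<le> (\<Sum>c\<in>C. p c)"
  using assms
proof (induction C arbitrary: f rule: finite_induct)
  case empty
  then show ?case by simp
next
  case (insert c C)
  \<comment> \<open>The conditional mean given all bits except that of \<open>c\<close>. As a convex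
    combination it inherits the bounded differences of \<open>f\<close>.\<close>
  define g where "g S = p c * f (insert c S) + (1 - p c) * f S" for S
  have p: "0 \<le> p c" "p c \<le> 1" using insert.prems(1) by auto
  have "\<bar>g (insert b S) - g S\<bar> \<le> 1" if "b \<in> C" "S \<subseteq> C" for b S
  proof -
    have "\<bar>f (insert c (insert b S)) - f (insert c S)\<bar> \<le> 1" "\<bar>f (insert b S) - f S\<bar> \<le> 1"
      using insert.prems(2)[of b "insert c S"] insert.prems(2)[of b S] that
      by (auto simp: insert_commute)
    then have "p c * \<bar>f (insert c (insert b S)) - f (insert c S)\<bar> +
        (1 - p c) * \<bar>f (insert b S) - f S\<bar> \<le> p c * 1 + (1 - p c) * 1"
      using p by (intro add_mono mult_left_mono) auto
    moreover have "g (insert b S) - g S = p c * (f (insert c (insert b S)) - f (insert c S)) +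
        (1 - p c) * (f (insert b S) - f S)"
      by (simp add: g_def algebra_simps)
    ultimately show ?thesis
      using p abs_triangle_ineq[of "p c * (f (insert c (insert b S)) - f (insert c S))"
          "(1 - p c) * (f (insert b S) - f S)"]
      by (simp add: abs_mult)
  qed
  then have IH: "bernoulli_expect C p (\<lambda>S. (g S)\<^sup>2) - (bernoulli_expect C p g)\<^sup>2 \<le> (\<Sum>c\<in>C. p c)"
    using insert.IH[of g] insert.prems(1) by auto
  have "p c * (f (insert c S))\<^sup>2 + (1 - p c) * (f S)\<^sup>2 \<le> p c + (g S)\<^sup>2" if "S \<subseteq> C" for S
  proof -
    have "p c * (f (insert c S))\<^sup>2 + (1 - p c) * (f S)\<^sup>2 =
        (p c * (1 - p c)) * (f (insert c S) - f S)\<^sup>2 + (g S)\<^sup>2"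
      by (simp add: g_def power2_eq_square algebra_simps)
    moreover have "(f (insert c S) - f S)\<^sup>2 \<le> 1"
      using insert.prems(2)[of c S] that by (auto simp: abs_square_le_1)
    then have "(p c * (1 - p c)) * (f (insert c S) - f S)\<^sup>2 \<le> (p c * 1) * 1"
      using p by (intro mult_mono) auto
    ultimately show ?thesis by simp
  qed
  then have "bernoulli_expect C p (\<lambda>S. p c * (f (insert c S))\<^sup>2 + (1 - p c) * (f S)\<^sup>2) \<le>
      bernoulli_expect C p (\<lambda>S. p c + (g S)\<^sup>2)"
    using insert.prems(1) by (intro bernoulli_expect_mono) auto
  also have "\<dots> = p c + bernoulli_expect C p (\<lambda>S. (g S)\<^sup>2)"
    using insert.hyps by (simp add: bernoulli_expect_add bernoulli_expect_const)
  finally show ?case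
    using IH insert.hyps by (simp add: bernoulli_expect_insert g_def[abs_def])
qed

section \<open>Occupied cells of a Poisson process\<close>

text \<open>The conditions of the independence clause of \<open>poisson_process\<close>, phrased for
  a set of cells instead of an indexed family.\<close>

definition cell_family :: "'a::euclidean_space set set \<Rightarrow> bool" where
  "cell_family C \<longleftrightarrow> finite C \<and> disjoint C \<and> (\<forall>c\<in>C. c \<in> sets borel \<and> bounded c)"

definition occupied :: "'a set \<Rightarrow> 'a set set \<Rightarrow> 'a set set" where
  "occupied V C = {c\<in>C. c \<inter> V \<noteq> {}}"

text \<open>One minus the Poisson weight of zero: the probability that \<open>c\<close> contains a
  point of the process.\<close>

definition hit_prob :: "real \<Rightarrow> 'a::euclidean_space set \<Rightarrow> real" where
  "hit_prob l c = 1 - exp (- (l * measure lborel c))"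

locale poisson_point_process = prob_space M for M :: "'w measure" +
  fixes l :: real and X :: "'w \<Rightarrow> 'a::euclidean_space set"
  assumes poisson: "poisson_process M l X" and intensity_pos: "l > 0"
begin

lemma finite_points: "\<omega> \<in> space M \<Longrightarrow> bounded B \<Longrightarrow> finite (X \<omega> \<inter> B)"
  using poisson unfolding poisson_process_def by blast

lemma measurable_count:
  "B \<in> sets borel \<Longrightarrow> bounded B \<Longrightarrow> (\<lambda>\<omega>. card (X \<omega> \<inter> B)) \<in> measurable M (count_space UNIV)"
  using poisson unfolding poisson_process_def by blast

lemma hit_prob_bounds: "0 \<le> hit_prob l c" "hit_prob l c \<le> 1"
  using intensity_pos by (simp_all add: hit_prob_def)

lemma hit_prob_le: "hit_prob l c \<le> l * measure lborel c"
  using exp_ge_add_one_self[of "- (l * measure lborel c)"] by (simp add: hit_prob_def)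

lemma prob_not_hit:
  assumes "c \<in> sets borel" "bounded c"
  shows "prob {\<omega>\<in>space M. c \<inter> X \<omega> = {}} = 1 - hit_prob l c"
proof -
  have "prob {\<omega>\<in>space M. card (X \<omega> \<inter> c) = 0} = 1 - hit_prob l c"
    using poisson assms unfolding poisson_process_def hit_prob_def by simp
  \<comment> \<open>\<open>card\<close> is 0 on infinite sets as well; local finiteness of the
    points excludes that case.\<close>
  moreover have "{\<omega>\<in>space M. card (X \<omega> \<inter> c) = 0} = {\<omega>\<in>space M. c \<inter> X \<omega> = {}}"
    using finite_points[OF _ assms(2)] by (auto simp: Int_commute)
  ultimately show ?thesis by simp
qed

lemma not_hit_event:
  assumes "c \<in> sets borel" "bounded c"
  shows "{\<omega>\<in>space M. c \<inter> X \<omega> = {}} \<in> events"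
proof -
  have "(\<lambda>\<omega>. card (X \<omega> \<inter> c)) -` {0} \<inter> space M \<in> events"
    using measurable_count[OF assms] by (rule measurable_sets) simp
  moreover have "(\<lambda>\<omega>. card (X \<omega> \<inter> c)) -` {0} \<inter> space M = {\<omega>\<in>space M. c \<inter> X \<omega> = {}}"
    using finite_points[OF _ assms(2)] by (auto simp: Int_commute)
  ultimately show ?thesis by simp
qed

lemma hit_event:
  assumes "c \<in> sets borel" "bounded c"
  shows "{\<omega>\<in>space M. c \<inter> X \<omega> \<noteq> {}} \<in> events"
proof -
  have "{\<omega>\<in>space M. c \<inter> X \<omega> \<noteq> {}} = space M - {\<omega>\<in>space M. c \<inter> X \<omega> = {}}" by auto
  then show ?thesis using not_hit_event[OF assms] by auto
qed

lemma prob_hit: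
  assumes "c \<in> sets borel" "bounded c"
  shows "prob {\<omega>\<in>space M. c \<inter> X \<omega> \<noteq> {}} = hit_prob l c"
proof -
  have "{\<omega>\<in>space M. c \<inter> X \<omega> \<noteq> {}} = space M - {\<omega>\<in>space M. c \<inter> X \<omega> = {}}" by auto
  then show ?thesis
    using prob_compl[OF not_hit_event[OF assms]] prob_not_hit[OF assms] by simp
qed

lemma occupied_event:
  assumes "cell_family C"
  shows "{\<omega>\<in>space M. occupied (X \<omega>) C = S} \<in> events"
proof (cases "S \<subseteq> C")
  case True
  have "{\<omega>\<in>space M. occupied (X \<omega>) C = S} =
      {\<omega>\<in>space M. \<forall>c\<in>C. (if c \<in> S then c \<inter> X \<omega> \<noteq> {} else c \<inter> X \<omega> = {})}"
    using True by (auto simp: occupied_def split: if_splits)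
  also have "\<dots> \<in> events"
  proof (rule sets.sets_Collect_finite_All)
    show "{\<omega>\<in>space M. if c \<in> S then c \<inter> X \<omega> \<noteq> {} else c \<inter> X \<omega> = {}} \<in> events" if "c \<in> C" for c
      using assms that hit_event[of c] not_hit_event[of c] by (cases "c \<in> S") (auto simp: cell_family_def)
    show "finite C" using assms by (simp add: cell_family_def)
  qed
  finally show ?thesis .
next
  case False
  then have "{\<omega>\<in>space M. occupied (X \<omega>) C = S} = {}"
    by (auto simp: occupied_def)
  then show ?thesis by (simp only: sets.empty_sets)
qed

text \<open>Whether a cell is occupied depends only on its count, and the counts of disjoint cells
  are independent.\<close>

lemma prob_occupied:
  assumes C: "cell_family C" and S: "S \<subseteq> C"
  shows "prob {\<omega>\<in>space M. occupied (X \<omega>) C = S} =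
    (\<Prod>c\<in>C. if c \<in> S then hit_prob l c else 1 - hit_prob l c)"
\<comment> \<open>An intersection over an empty index set would be \<open>UNIV\<close> rather than
  \<open>space M\<close>, hence the separate case.\<close>
proof (cases "C = {}")
  case True
  then show ?thesis using S by (simp add: occupied_def prob_space)
next
  case False
  have fin: "finite C" using C by (simp add: cell_family_def)
  \<comment> \<open>The independence clause speaks of families indexed by natural numbers, so the
    cells are enumerated.\<close>
  obtain h where h: "bij_betw h {0..<card C} C"
    using ex_bij_betw_nat_finite[OF fin] by blast
  define I where "I = {0..<card C}"
  have I: "finite I" "I \<noteq> {}" using False fin by (auto simp: I_def)
  have C_eq: "C = h ` I"
    using h by (simp add: I_def bij_betw_def)
  have hC: "h i \<in> C" if "i \<in> I" for i
    using h that by (auto simp: I_def bij_betw_def)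
  have "disjoint_family_on h I"
    using C h hC unfolding disjoint_family_on_def cell_family_def I_def bij_betw_def inj_on_def
    by (metis disjointD)
  moreover have hb: "\<forall>i\<in>I. h i \<in> sets borel \<and> bounded (h i)"
    using C hC by (auto simp: cell_family_def)
  ultimately have indep: "indep_vars (\<lambda>_. count_space UNIV) (\<lambda>i \<omega>. card (X \<omega> \<inter> h i)) I"
    using poisson I(1) unfolding poisson_process_def by blast
  define A where "A i = (if h i \<in> S then {0<..} else {0::nat})" for i
  define P where "P i \<omega> \<longleftrightarrow> (if h i \<in> S then h i \<inter> X \<omega> \<noteq> {} else h i \<inter> X \<omega> = {})" for i \<omega>
  have eq: "(\<lambda>\<omega>. card (X \<omega> \<inter> h i)) -` A i \<inter> space M = {\<omega>\<in>space M. P i \<omega>}" if "i \<in> I" for i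
    using finite_points[of _ "h i"] hb that
    by (auto simp: A_def P_def Int_commute card_gt_0_iff split: if_splits)
  have "{\<omega>\<in>space M. occupied (X \<omega>) C = S} =
      {\<omega>\<in>space M. \<forall>c\<in>C. (if c \<in> S then c \<inter> X \<omega> \<noteq> {} else c \<inter> X \<omega> = {})}"
    using S by (auto simp: occupied_def split: if_splits)
  also have "\<dots> = {\<omega>\<in>space M. \<forall>i\<in>I. P i \<omega>}"
    by (simp add: C_eq P_def)
  also have "\<dots> = (\<Inter>i\<in>I. {\<omega>\<in>space M. P i \<omega>})"
    using I(2) by auto
  also have "\<dots> = (\<Inter>i\<in>I. (\<lambda>\<omega>. card (X \<omega> \<inter> h i)) -` A i \<inter> space M)"
    by (intro INF_cong refl) (simp only: eq)
  also have "prob \<dots> = (\<Prod>i\<in>I. prob ((\<lambda>\<omega>. card (X \<omega> \<inter> h i)) -` A i \<inter> space M))"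
    using indep I by (intro indep_varsD_finite) auto
  also have "\<dots> = (\<Prod>i\<in>I. if h i \<in> S then hit_prob l (h i) else 1 - hit_prob l (h i))"
    using hb by (intro prod.cong refl) (simp add: eq P_def prob_hit prob_not_hit)
  also have "\<dots> = (\<Prod>c\<in>C. if c \<in> S then hit_prob l c else 1 - hit_prob l c)"
    using prod.reindex_bij_betw[OF h] by (simp add: I_def)
  finally show ?thesis .
qed

text \<open>The occupancy pattern takes finitely many values, so the function is a finite
  combination of indicators of events whose probabilities \<open>prob_occupied\<close> gives.
  Integrals over \<open>M\<close> thereby become finite sums.\<close>

lemma occupied_expectation:
  fixes f :: "'a set set \<Rightarrow> real"
  assumes C: "cell_family C"
  shows "has_bochner_integral M (\<lambda>\<omega>. f (occupied (X \<omega>) C)) (bernoulli_expect C (hit_prob l) f)"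
proof -
  have fin: "finite (Pow C)" using C by (simp add: cell_family_def)
  have "has_bochner_integral M
      (\<lambda>\<omega>. \<Sum>S\<in>Pow C. f S * indicator {\<omega>\<in>space M. occupied (X \<omega>) C = S} \<omega>)
      (\<Sum>S\<in>Pow C. f S * prob {\<omega>\<in>space M. occupied (X \<omega>) C = S})"
    using occupied_event[OF C]
    by (intro has_bochner_integral_sum has_bochner_integral_mult_right has_bochner_integral_real_indicator)
      (auto simp: emeasure_eq_measure)
  moreover have "(\<Sum>S\<in>Pow C. f S * prob {\<omega>\<in>space M. occupied (X \<omega>) C = S}) =
      bernoulli_expect C (hit_prob l) f"
    unfolding bernoulli_expect_def using prob_occupied[OF C] by (intro sum.cong) auto
  moreover have "(\<Sum>S\<in>Pow C. f S * indicator {\<omega>\<in>space M. occupied (X \<omega>) C = S} \<omega>) =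
      f (occupied (X \<omega>) C)" if "\<omega> \<in> space M" for \<omega>
  proof -
    have "(\<Sum>S\<in>Pow C. f S * indicator {\<omega>\<in>space M. occupied (X \<omega>) C = S} \<omega>) =
        (\<Sum>S\<in>Pow C. if occupied (X \<omega>) C = S then f S else 0)"
      using that by (intro sum.cong) (auto simp: indicator_def)
    also have "\<dots> = f (occupied (X \<omega>) C)"
      using fin by (simp add: occupied_def)
    finally show ?thesis .
  qed
  ultimately show ?thesis
    by (subst has_bochner_integral_cong[OF refl _ refl]) auto
qed

lemma occupied_measurable:
  fixes f :: "'a set set \<Rightarrow> real"
  assumes "cell_family C"
  shows "(\<lambda>\<omega>. f (occupied (X \<omega>) C)) \<in> borel_measurable M"
  using occupied_expectation[OF assms] by (blast elim: has_bochner_integral.cases)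

text \<open>The bit of \<open>b\<close> is independent of the bits of \<open>C\<close>, and its
  centred version has mean zero. Integrating out that bit first already gives 0.\<close>

lemma centred_hit_uncorrelated:
  fixes f :: "'a set set \<Rightarrow> real"
  assumes C: "cell_family (insert b C)" "b \<notin> C"
  shows "has_bochner_integral M
    (\<lambda>\<omega>. f (occupied (X \<omega>) C) * (of_bool (b \<inter> X \<omega> \<noteq> {}) - hit_prob l b)) 0"
proof -
  \<comment> \<open>Intersecting with \<open>C\<close> makes \<open>f\<close> blind to the bit of
    \<open>b\<close>.\<close>
  define g where "g S = f (S \<inter> C) * (of_bool (b \<in> S) - hit_prob l b)" for S
  have fin: "finite C" using C by (simp add: cell_family_def)
  have "bernoulli_expect (insert b C) (hit_prob l) g =
      bernoulli_expect C (hit_prob l) (\<lambda>_. 0)"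
    unfolding bernoulli_expect_insert[OF fin C(2)]
    using C(2) by (intro bernoulli_expect_cong) (auto simp: g_def algebra_simps)
  then have "bernoulli_expect (insert b C) (hit_prob l) g = 0"
    by (simp add: bernoulli_expect_const[OF fin])
  moreover have "g (occupied (X \<omega>) (insert b C)) =
      f (occupied (X \<omega>) C) * (of_bool (b \<inter> X \<omega> \<noteq> {}) - hit_prob l b)" for \<omega>
  proof -
    have "occupied (X \<omega>) (insert b C) \<inter> C = occupied (X \<omega>) C"
      by (auto simp: occupied_def)
    then show ?thesis by (simp add: g_def occupied_def)
  qed
  ultimately show ?thesis
    using occupied_expectation[OF C(1), of g] by simp
qed

end

section \<open>Discretisation\<close>

text \<open>The lower corner of the half-open grid cell of \<open>x\<close>. Using
  \<open>Suc n\<close> keeps the mesh finite at \<open>n = 0\<close>.\<close>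

definition grid_round :: "nat \<Rightarrow> 'a::euclidean_space \<Rightarrow> 'a" where
  "grid_round n x = (\<Sum>b\<in>Basis. (of_int \<lfloor>real (Suc n) * (x \<bullet> b)\<rfloor> / real (Suc n)) *\<^sub>R b)"

text \<open>An l1 estimate of the displacement under rounding, one mesh width per coordinate. The
  type argument only supplies the dimension.\<close>

definition grid_error :: "'a::euclidean_space itself \<Rightarrow> nat \<Rightarrow> real" where
  "grid_error _ n = real DIM('a) / real (Suc n)"

lemma grid_error_tendsto: "grid_error TYPE('a::euclidean_space) \<longlonglongrightarrow> 0"
  unfolding grid_error_def[abs_def] by real_asymp

lemma grid_error_bounds:
  "0 \<le> grid_error TYPE('a::euclidean_space) n" "grid_error TYPE('a) n \<le> real DIM('a)"
  by (simp_all add: grid_error_def field_simps)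

lemma norm_grid_round_diff_le:
  fixes x :: "'a::euclidean_space"
  shows "norm (grid_round n x - x) \<le> grid_error TYPE('a) n"
proof -
  have "\<bar>(grid_round n x - x) \<bullet> b\<bar> \<le> 1 / real (Suc n)" if "b \<in> Basis" for b
  proof -
    have "(grid_round n x - x) \<bullet> b =
        (of_int \<lfloor>real (Suc n) * (x \<bullet> b)\<rfloor> - real (Suc n) * (x \<bullet> b)) / real (Suc n)"
      using that unfolding grid_round_def by (simp add: inner_diff_left field_simps)
    moreover have "\<bar>of_int \<lfloor>real (Suc n) * (x \<bullet> b)\<rfloor> - real (Suc n) * (x \<bullet> b)\<bar> \<le> 1"
      by linarith
    ultimately show ?thesis
      by (simp add: divide_right_mono)
  qed
  then have "(\<Sum>b\<in>Basis. \<bar>(grid_round n x - x) \<bullet> b\<bar>) \<le> real DIM('a) * (1 / real (Suc n))"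
    by (rule sum_bounded_above)
  then show ?thesis
    using norm_le_l1[of "grid_round n x - x"] by (simp add: grid_error_def)
qed

text \<open>Each of the two endpoints moves by at most \<open>grid_error\<close>. This decides how
  far the radius must be enlarged.\<close>

lemma norm_grid_round_near:
  fixes u v :: "'a::euclidean_space"
  shows "\<bar>norm (grid_round n u - grid_round n v) - norm (u - v)\<bar> \<le> 2 * grid_error TYPE('a) n"
proof -
  have "norm ((grid_round n u - grid_round n v) - (u - v)) =
      norm ((grid_round n u - u) - (grid_round n v - v))"
    by (simp add: algebra_simps)
  also have "\<dots> \<le> norm (grid_round n u - u) + norm (grid_round n v - v)"
    by (rule norm_triangle_ineq4)
  also have "\<dots> \<le> 2 * grid_error TYPE('a) n"
    using norm_grid_round_diff_le[of n u] norm_grid_round_diff_le[of n v] by simp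
  finally show ?thesis
    using norm_triangle_ineq3[of "grid_round n u - grid_round n v" "u - v"] by linarith
qed

lemma grid_round_measurable: "grid_round n \<in> borel_measurable borel"
  unfolding grid_round_def[abs_def] by measurable

text \<open>On a bounded set every coordinate has only finitely many floors, so rounded points are
  parametrised by a finite product of integer intervals.\<close>

lemma finite_grid_round_image:
  fixes W :: "'a::euclidean_space set"
  assumes "bounded W"
  shows "finite (grid_round n ` W)"
proof -
  obtain K where K: "\<And>x. x \<in> W \<Longrightarrow> norm x \<le> K"
    using assms by (auto simp: bounded_iff)
  define K' where "K' = \<lceil>real (Suc n) * K\<rceil> + 1"
  define r where "r h = (\<Sum>b\<in>Basis. (of_int (h b) / real (Suc n)) *\<^sub>R b)" for h :: "'a \<Rightarrow> int"
  have "grid_round n ` W \<subseteq> r ` (PiE Basis (\<lambda>_. {-K'..K'}))"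
  proof
    fix y assume "y \<in> grid_round n ` W"
    then obtain x where x: "x \<in> W" "y = grid_round n x" by blast
    define h where "h = restrict (\<lambda>b. \<lfloor>real (Suc n) * (x \<bullet> b)\<rfloor>) (Basis :: 'a set)"
    have "h \<in> PiE Basis (\<lambda>_. {-K'..K'})"
    proof (rule PiE_I)
      fix b :: 'a assume b: "b \<in> Basis"
      have "\<bar>x \<bullet> b\<bar> \<le> K"
        using Basis_le_norm[OF b, of x] K[OF x(1)] by linarith
      then have "real (Suc n) * \<bar>x \<bullet> b\<bar> \<le> real (Suc n) * K"
        by (intro mult_left_mono) auto
      then have "\<bar>real (Suc n) * (x \<bullet> b)\<bar> \<le> real (Suc n) * K"
        by (simp only: abs_mult abs_of_nat)
      then have "\<lfloor>real (Suc n) * (x \<bullet> b)\<rfloor> \<in> {-K'..K'}"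
        unfolding K'_def atLeastAtMost_iff by linarith
      then show "h b \<in> {-K'..K'}" using b by (simp add: h_def)
    qed (simp add: h_def)
    moreover have "y = r h"
      unfolding x(2) r_def grid_round_def by (intro sum.cong) (auto simp: h_def)
    ultimately show "y \<in> r ` (PiE Basis (\<lambda>_. {-K'..K'}))" by blast
  qed
  then show ?thesis
    by (rule finite_subset) (intro finite_imageI finite_PiE, auto)
qed

text \<open>Fibres of the rounding within \<open>W\<close>. Taking only attained values keeps the
  cells nonempty, which later separates them from sets disjoint from \<open>W\<close>.\<close>

definition grid_cells :: "nat \<Rightarrow> 'a::euclidean_space set \<Rightarrow> 'a set set" where
  "grid_cells n W = (\<lambda>p. W \<inter> grid_round n -` {p}) ` grid_round n ` W"

lemma Union_grid_cells: "\<Union>(grid_cells n W) = W"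
  by (auto simp: grid_cells_def)

lemma grid_cells_nonempty: "{} \<notin> grid_cells n W"
  by (auto simp: grid_cells_def)

lemma cell_family_grid_cells:
  assumes "W \<in> sets borel" "bounded W"
  shows "cell_family (grid_cells n W)"
  unfolding cell_family_def
proof (intro conjI ballI)
  show "finite (grid_cells n W)"
    unfolding grid_cells_def using finite_grid_round_image[OF assms(2)] by blast
  show "disjoint (grid_cells n W)"
    by (auto simp: grid_cells_def disjoint_def)
  fix c assume "c \<in> grid_cells n W"
  then obtain p where c: "c = W \<inter> grid_round n -` {p}" by (auto simp: grid_cells_def)
  have "grid_round n -` {p} \<inter> space borel \<in> sets borel"
    using grid_round_measurable by (rule measurable_sets) simp
  then show "c \<in> sets borel" using assms(1) c by auto
  show "bounded c" using assms(2) c by (simp add: bounded_Int)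
qed

text \<open>Rounding is constant on a cell, so every point of an occupied cell has the same image as
  a point of \<open>V\<close> in it. The rounded point set is thus a function of the occupancy
  pattern.\<close>

lemma grid_round_occupied:
  "grid_round n ` \<Union>(occupied V (grid_cells n W)) = grid_round n ` (W \<inter> V)"
proof (intro equalityI subsetI)
  fix p assume "p \<in> grid_round n ` \<Union>(occupied V (grid_cells n W))"
  then obtain c x where c: "c \<in> grid_cells n W" "c \<inter> V \<noteq> {}" "x \<in> c" "p = grid_round n x"
    unfolding occupied_def by blast
  then obtain y where "y \<in> W" "y \<in> V" "grid_round n y = p"
    unfolding grid_cells_def by auto
  then show "p \<in> grid_round n ` (W \<inter> V)" by blast
next
  fix p assume "p \<in> grid_round n ` (W \<inter> V)"
  then obtain x where x: "x \<in> W" "x \<in> V" "p = grid_round n x" by blast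
  define c where "c = W \<inter> grid_round n -` {p}"
  have "x \<in> c" using x by (simp add: c_def)
  moreover have "c \<in> grid_cells n W" using x unfolding c_def grid_cells_def by blast
  ultimately show "p \<in> grid_round n ` \<Union>(occupied V (grid_cells n W))"
    using x unfolding occupied_def by blast
qed

text \<open>The radius is enlarged so that rounding cannot lose an edge.\<close>

definition grid_colorable :: "nat \<Rightarrow> nat \<Rightarrow> 'a::euclidean_space set \<Rightarrow> real" where
  "grid_colorable k n V =
     real (max_colorable k (1 + 2 * grid_error TYPE('a) n) (grid_round n ` V))"

lemma grid_colorable_occupied:
  "grid_colorable k n (\<Union>(occupied V (grid_cells n W))) = grid_colorable k n (W \<inter> V)"
  by (simp add: grid_colorable_def grid_round_occupied)

text \<open>A finite set has finitely many distances; once the grid error is small against those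
  that are positive and against the gaps of those above 1, rounding is a graph isomorphism.\<close>

lemma eventually_grid_colorable_eq:
  fixes V :: "'a::euclidean_space set"
  assumes "finite V"
  shows "\<forall>\<^sub>F n in sequentially. grid_colorable k n V = real (max_colorable k 1 V)"
proof -
  have small: "\<forall>\<^sub>F n in sequentially. grid_error TYPE('a) n < e" if "e > 0" for e
    using order_tendstoD(2)[OF grid_error_tendsto that] .
  \<comment> \<open>The first condition gives injectivity. In the second, two of the four errors
    come from the distortion of distances and two from the enlarged radius.\<close>
  have "\<forall>\<^sub>F n in sequentially. (u \<noteq> v \<longrightarrow> 2 * grid_error TYPE('a) n < norm (u - v)) \<and>
      (norm (u - v) > 1 \<longrightarrow> 4 * grid_error TYPE('a) n < norm (u - v) - 1)" for u v :: 'a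
  proof (intro eventually_conj)
    show "\<forall>\<^sub>F n in sequentially. u \<noteq> v \<longrightarrow> 2 * grid_error TYPE('a) n < norm (u - v)"
      using small[of "norm (u - v) / 2"] by (cases "u = v") (auto elim: eventually_mono)
    show "\<forall>\<^sub>F n in sequentially. norm (u - v) > 1 \<longrightarrow>
        4 * grid_error TYPE('a) n < norm (u - v) - 1"
      using small[of "(norm (u - v) - 1) / 4"]
      by (cases "norm (u - v) > 1") (auto elim: eventually_mono)
  qed
  then have "\<forall>\<^sub>F n in sequentially. \<forall>u\<in>V. \<forall>v\<in>V.
      (u \<noteq> v \<longrightarrow> 2 * grid_error TYPE('a) n < norm (u - v)) \<and>
      (norm (u - v) > 1 \<longrightarrow> 4 * grid_error TYPE('a) n < norm (u - v) - 1)"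
    using assms by (intro eventually_ball_finite ballI)
  then show ?thesis
  proof (rule eventually_mono)
    fix n assume n: "\<forall>u\<in>V. \<forall>v\<in>V.
      (u \<noteq> v \<longrightarrow> 2 * grid_error TYPE('a) n < norm (u - v)) \<and>
      (norm (u - v) > 1 \<longrightarrow> 4 * grid_error TYPE('a) n < norm (u - v) - 1)"
    have "inj_on (grid_round n) V"
    proof (rule inj_onI, rule ccontr)
      fix u v assume "u \<in> V" "v \<in> V" "grid_round n u = grid_round n v" "u \<noteq> v"
      then show False using n norm_grid_round_near[of n u v] by fastforce
    qed
    moreover have "norm (grid_round n u - grid_round n v) \<le> 1 + 2 * grid_error TYPE('a) n \<longleftrightarrow>
        norm (u - v) \<le> 1" if "u \<in> V" "v \<in> V" for u v
      using n that norm_grid_round_near[of n u v] by (smt (verit, best))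
    ultimately show "grid_colorable k n V = real (max_colorable k 1 V)"
      unfolding grid_colorable_def by (subst max_colorable_image) auto
  qed
qed

text \<open>The clique cover bound, uniform in \<open>n\<close> and \<open>V\<close>, provides the
  constant majorant for passing to the limit in expectations.\<close>

lemma grid_colorable_bounded:
  fixes W :: "'a::euclidean_space set"
  assumes "bounded W"
  obtains K where "\<And>n V. V \<subseteq> W \<Longrightarrow> finite V \<Longrightarrow> grid_colorable k n V \<le> K"
proof -
  obtain R where R: "\<And>x. x \<in> W \<Longrightarrow> norm x \<le> R"
    using assms by (auto simp: bounded_iff)
  \<comment> \<open>For every \<open>n\<close> the rounded points have norm at most
    \<open>R + DIM('a)\<close>. Distinct points in one ball of radius 1/2 are closer than 1, hence
    adjacent at every enlarged radius.\<close>
  obtain J :: "'a set" where J: "finite J" "cball 0 (R + real DIM('a)) \<subseteq> (\<Union>x\<in>J. ball x (1/2))"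
    using compact_cball[of "0::'a" "R + real DIM('a)"] unfolding compact_eq_totally_bounded
    by (meson half_gt_zero zero_less_one)
  have "grid_colorable k n V \<le> real (card J * k)" if V: "V \<subseteq> W" "finite V" for n V
    unfolding grid_colorable_def
  proof (intro of_nat_mono max_colorable_le_cover[where Q = "\<lambda>x. ball x (1/2)"])
    show "finite (grid_round n ` V)" using V by simp
    show "finite J" by (rule J(1))
    have "norm (grid_round n x) \<le> R + real DIM('a)" if "x \<in> V" for x
      using R[of x] that V(1) norm_grid_round_diff_le[of n x] grid_error_bounds(2)[of n, where 'a='a]
        norm_triangle_sub[of "grid_round n x" x] by fastforce
    then show "grid_round n ` V \<subseteq> (\<Union>x\<in>J. ball x (1/2))"
      using J(2) by (force simp: subset_iff)
    fix x u v :: 'a assume "u \<in> ball x (1/2)" "v \<in> ball x (1/2)"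
    then have "dist u v < 1" using dist_triangle_half_r[of x u 1 v] by simp
    then show "norm (u - v) \<le> 1 + 2 * grid_error TYPE('a) n"
      using grid_error_bounds(1)[of n, where 'a='a] by (simp add: dist_norm)
  qed
  then show ?thesis using that by blast
qed

section \<open>Bounded functionals of the process and the upper variance bound\<close>

context prob_space
begin

lemma bounded_convergence:
  fixes f :: "'a \<Rightarrow> real"
  assumes s: "\<And>n. s n \<in> borel_measurable M"
    and lim: "\<And>\<omega>. \<omega> \<in> space M \<Longrightarrow> (\<lambda>n. s n \<omega>) \<longlonglongrightarrow> f \<omega>"
    and bound: "\<And>n \<omega>. \<omega> \<in> space M \<Longrightarrow> \<bar>s n \<omega>\<bar> \<le> K"
  shows "(\<lambda>n. expectation (s n)) \<longlonglongrightarrow> expectation f"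
proof (rule integral_dominated_convergence)
  show "f \<in> borel_measurable M"
    using lim s by (rule borel_measurable_LIMSEQ_real)
  show "integrable M (\<lambda>_. K)" by simp
qed (use assms in auto)

text \<open>A class closed under sums, differences and products and made of integrable functions, so
  products need no separate integrability argument.\<close>

definition bounded_rv :: "('a \<Rightarrow> real) \<Rightarrow> bool" where
  "bounded_rv f \<longleftrightarrow> f \<in> borel_measurable M \<and> (\<exists>K. \<forall>\<omega>\<in>space M. \<bar>f \<omega>\<bar> \<le> K)"

lemma bounded_rv_const: "bounded_rv (\<lambda>_. x)"
  by (auto simp: bounded_rv_def)

lemma bounded_rv_mult:
  assumes "bounded_rv f" "bounded_rv g"
  shows "bounded_rv (\<lambda>\<omega>. f \<omega> * g \<omega>)"
proof -
  obtain K K' where K: "\<forall>\<omega>\<in>space M. \<bar>f \<omega>\<bar> \<le> K" "\<forall>\<omega>\<in>space M. \<bar>g \<omega>\<bar> \<le> K'"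
    using assms unfolding bounded_rv_def by blast
  have "\<bar>f \<omega> * g \<omega>\<bar> \<le> K * K'" if "\<omega> \<in> space M" for \<omega>
    unfolding abs_mult using K that by (intro mult_mono) force+
  then show ?thesis using assms unfolding bounded_rv_def by (auto intro!: borel_measurable_times)
qed

lemma bounded_rv_add:
  assumes "bounded_rv f" "bounded_rv g"
  shows "bounded_rv (\<lambda>\<omega>. f \<omega> + g \<omega>)"
proof -
  obtain K K' where K: "\<forall>\<omega>\<in>space M. \<bar>f \<omega>\<bar> \<le> K" "\<forall>\<omega>\<in>space M. \<bar>g \<omega>\<bar> \<le> K'"
    using assms unfolding bounded_rv_def by blast
  have "\<bar>f \<omega> + g \<omega>\<bar> \<le> K + K'" if "\<omega> \<in> space M" for \<omega>
    using K that abs_triangle_ineq[of "f \<omega>" "g \<omega>"] by force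
  then show ?thesis using assms unfolding bounded_rv_def by (auto intro!: borel_measurable_add)
qed

lemma bounded_rv_diff:
  assumes "bounded_rv f" "bounded_rv g"
  shows "bounded_rv (\<lambda>\<omega>. f \<omega> - g \<omega>)"
  using bounded_rv_add[OF assms(1) bounded_rv_mult[OF bounded_rv_const[of "-1"] assms(2)]] by simp

lemma bounded_rv_sum:
  assumes "\<And>i. i \<in> I \<Longrightarrow> bounded_rv (f i)"
  shows "bounded_rv (\<lambda>\<omega>. \<Sum>i\<in>I. f i \<omega>)"
  using assms
  by (induction I rule: infinite_finite_induct) (auto intro: bounded_rv_add bounded_rv_const)

lemma bounded_rv_integrable: "bounded_rv f \<Longrightarrow> integrable M f"
  unfolding bounded_rv_def by (metis AE_I2 integrable_const_bound real_norm_def)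

text \<open>Expand \<open>0 \<le> E (f - E f - g)\<^sup>2\<close> for the sum \<open>g\<close> of all \<open>h i\<close>.\<close>

lemma variance_ge_orthogonal:
  fixes v :: real
  assumes f: "bounded_rv f" and h: "\<And>i. i \<in> I \<Longrightarrow> bounded_rv (h i)" and "finite I"
    and mean: "\<And>i. i \<in> I \<Longrightarrow> expectation (h i) = 0"
    and orth: "\<And>i j. i \<in> I \<Longrightarrow> j \<in> I \<Longrightarrow>
      expectation (\<lambda>\<omega>. h i \<omega> * h j \<omega>) = (if i = j then v else 0)"
    and corr: "\<And>i. i \<in> I \<Longrightarrow> expectation (\<lambda>\<omega>. f \<omega> * h i \<omega>) \<ge> v"
  shows "variance f \<ge> card I * v"
proof -
  define m where "m = expectation f"
  define g where "g \<omega> = (\<Sum>i\<in>I. h i \<omega>)" for \<omega>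
  have g: "bounded_rv g"
    unfolding g_def using h by (rule bounded_rv_sum)
  note [intro] = bounded_rv_integrable bounded_rv_mult bounded_rv_add bounded_rv_diff bounded_rv_const
  have "expectation (\<lambda>\<omega>. f \<omega> * g \<omega>) = (\<Sum>i\<in>I. expectation (\<lambda>\<omega>. f \<omega> * h i \<omega>))"
    unfolding g_def sum_distrib_left using f h by (intro Bochner_Integration.integral_sum) auto
  also have "\<dots> \<ge> (\<Sum>i\<in>I. v)"
    using corr by (rule sum_mono)
  finally have fg: "expectation (\<lambda>\<omega>. f \<omega> * g \<omega>) \<ge> card I * v" by simp
  \<comment> \<open>The \<open>h i\<close> are centred, which removes the cross term with the mean
    \<open>m\<close>.\<close>
  have g0: "expectation g = 0"
    unfolding g_def using h mean by (subst Bochner_Integration.integral_sum) auto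
  have "expectation (\<lambda>\<omega>. g \<omega> * g \<omega>) = (\<Sum>i\<in>I. \<Sum>j\<in>I. expectation (\<lambda>\<omega>. h i \<omega> * h j \<omega>))"
    unfolding g_def sum_product using h
    by (subst Bochner_Integration.integral_sum)
      (auto intro!: Bochner_Integration.integral_sum sum.cong Bochner_Integration.integrable_sum)
  also have "\<dots> = (\<Sum>i\<in>I. \<Sum>j\<in>I. if i = j then v else 0)"
    using orth by (intro sum.cong) auto
  also have "\<dots> = card I * v"
    using \<open>finite I\<close> by simp
  finally have gg: "expectation (\<lambda>\<omega>. g \<omega> * g \<omega>) = card I * v" .
  have "0 \<le> expectation (\<lambda>\<omega>. (f \<omega> - m - g \<omega>)\<^sup>2)" by simp
  also have "\<dots> = expectation (\<lambda>\<omega>. ((f \<omega> - m)\<^sup>2 + (2 * m) * g \<omega> + g \<omega> * g \<omega>) - 2 * (f \<omega> * g \<omega>))"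
    by (intro Bochner_Integration.integral_cong) (auto simp: power2_eq_square algebra_simps)
  also have "\<dots> = variance f + 2 * m * expectation g + expectation (\<lambda>\<omega>. g \<omega> * g \<omega>)
      - 2 * expectation (\<lambda>\<omega>. f \<omega> * g \<omega>)"
  proof -
    have [simp]: "integrable M (\<lambda>\<omega>. (f \<omega> - m)\<^sup>2)" "integrable M g"
      "integrable M (\<lambda>\<omega>. g \<omega> * g \<omega>)" "integrable M (\<lambda>\<omega>. f \<omega> * g \<omega>)"
      unfolding power2_eq_square
      by (intro bounded_rv_integrable bounded_rv_mult bounded_rv_diff bounded_rv_const f g)+
    show ?thesis unfolding m_def[symmetric] by simp
  qed
  \<comment> \<open>The variance plus \<open>card I * v\<close> is at least twice the mean of
    \<open>f * g\<close>, which in turn is at least \<open>card I * v\<close>.\<close>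
  finally show ?thesis using fg g0 gg by simp
qed

end

section \<open>Measurability of the colouring number of a window and the upper bound\<close>

context poisson_point_process
begin

context
  fixes W :: "'a set" and k :: nat
  assumes W: "W \<in> sets borel" "bounded W"
begin

lemma finite_window: "\<omega> \<in> space M \<Longrightarrow> finite (W \<inter> X \<omega>)"
  using finite_points[OF _ W(2)] by (simp add: Int_commute)

lemma grid_colorable_tendsto:
  "\<omega> \<in> space M \<Longrightarrow>
    (\<lambda>n. grid_colorable k n (W \<inter> X \<omega>)) \<longlonglongrightarrow> real (max_colorable k 1 (W \<inter> X \<omega>))"
  by (intro tendsto_eventually eventually_grid_colorable_eq finite_window)

text \<open>For fixed \<open>n\<close> this is a function of the finitely many occupancy bits of the
  grid cells.\<close>

lemma grid_colorable_measurable: "(\<lambda>\<omega>. grid_colorable k n (W \<inter> X \<omega>)) \<in> borel_measurable M"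
  using occupied_measurable[OF cell_family_grid_cells[OF W],
      of "\<lambda>S. grid_colorable k n (\<Union>S)" n]
  by (simp add: grid_colorable_occupied)

lemma bounded_max_colorable:
  obtains K where "\<And>n \<omega>. \<omega> \<in> space M \<Longrightarrow> \<bar>grid_colorable k n (W \<inter> X \<omega>)\<bar> \<le> K"
    "\<And>\<omega>. \<omega> \<in> space M \<Longrightarrow> real (max_colorable k 1 (W \<inter> X \<omega>)) \<le> K"
proof -
  obtain K where K: "\<And>n V. V \<subseteq> W \<Longrightarrow> finite V \<Longrightarrow> grid_colorable k n V \<le> K"
    using grid_colorable_bounded[OF W(2)] by blast
  show ?thesis
  proof (rule that)
    show *: "\<bar>grid_colorable k n (W \<inter> X \<omega>)\<bar> \<le> K" if "\<omega> \<in> space M" for n \<omega>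
      using K[of "W \<inter> X \<omega>" n] finite_window[OF that] by (simp add: grid_colorable_def)
    show "real (max_colorable k 1 (W \<inter> X \<omega>)) \<le> K" if "\<omega> \<in> space M" for \<omega>
      using grid_colorable_tendsto[OF that] by (rule LIMSEQ_le_const2) (use abs_le_D1[OF *[OF that]] in blast)
  qed
qed

text \<open>The process is only known to have measurable counts, so measurability is obtained from
  the pointwise limit of the discretised numbers.\<close>

lemma bounded_rv_max_colorable: "bounded_rv (\<lambda>\<omega>. real (max_colorable k 1 (W \<inter> X \<omega>)))"
proof -
  have "(\<lambda>\<omega>. real (max_colorable k 1 (W \<inter> X \<omega>))) \<in> borel_measurable M"
    using grid_colorable_tendsto grid_colorable_measurable by (rule borel_measurable_LIMSEQ_real)
  then show ?thesis
    unfolding bounded_rv_def using bounded_max_colorable by (metis abs_of_nat)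
qed

text \<open>Each hit probability is at most the mean count of the cell, and the mean counts add up
  over disjoint cells. The bound does not depend on the mesh.\<close>

lemma sum_hit_prob_grid_cells: "(\<Sum>c\<in>grid_cells n W. hit_prob l c) \<le> l * measure lborel W"
proof -
  have C: "finite (grid_cells n W)" "disjoint (grid_cells n W)" "\<forall>c\<in>grid_cells n W. c \<in> sets borel \<and> bounded c"
    using cell_family_grid_cells[OF W, of n] by (auto simp: cell_family_def)
  have "(\<Sum>c\<in>grid_cells n W. measure lborel c) = measure lborel (\<Union>c\<in>grid_cells n W. c)"
  proof (rule measure_finite_Union[symmetric])
    show "disjoint_family_on (\<lambda>c. c) (grid_cells n W)"
      using C(2) by (auto simp: disjoint_family_on_def disjoint_def)
    show "emeasure lborel c \<noteq> \<infinity>" if "c \<in> grid_cells n W" for c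
      using emeasure_bounded_finite[of c] C(3) that by (simp add: less_top)
  qed (use C in auto)
  then have "(\<Sum>c\<in>grid_cells n W. l * measure lborel c) = l * measure lborel W"
    using Union_grid_cells[of n W] by (simp add: sum_distrib_left[symmetric])
  moreover have "(\<Sum>c\<in>grid_cells n W. hit_prob l c) \<le> (\<Sum>c\<in>grid_cells n W. l * measure lborel c)"
    by (intro sum_mono hit_prob_le)
  ultimately show ?thesis by simp
qed

text \<open>Switching on one cell adds at most one rounded point and so changes the number by at
  most 1; the tensorised bound then sums the hit probabilities.\<close>

lemma variance_grid_colorable_le:
  "expectation (\<lambda>\<omega>. (grid_colorable k n (W \<inter> X \<omega>))\<^sup>2)
    - (expectation (\<lambda>\<omega>. grid_colorable k n (W \<inter> X \<omega>)))\<^sup>2 \<le> l * measure lborel W"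
proof -
  define C where "C = grid_cells n W"
  define f where "f S = grid_colorable k n (\<Union>S)" for S :: "'a set set"
  have C: "cell_family C" unfolding C_def by (rule cell_family_grid_cells[OF W])
  have f: "f (occupied (X \<omega>) C) = grid_colorable k n (W \<inter> X \<omega>)" for \<omega>
    by (simp add: f_def C_def grid_colorable_occupied)
  have "\<bar>f (insert c S) - f S\<bar> \<le> 1" if "c \<in> C" "S \<subseteq> C" for c S
  proof -
    have "\<exists>p\<in>grid_round n ` W. c = W \<inter> grid_round n -` {p}"
      using that(1) unfolding C_def grid_cells_def by (simp only: image_iff)
    then obtain p where p: "p \<in> grid_round n ` W" "c = W \<inter> grid_round n -` {p}"
      by (rule bexE)
    \<comment> \<open>A cell is a nonempty fibre, so it rounds to exactly one point.\<close>
    then have "grid_round n ` c = {p}" by auto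
    then have eq: "grid_round n ` \<Union>(insert c S) = insert p (grid_round n ` \<Union>S)" by auto
    have "\<Union>S \<subseteq> W" using that(2) Union_grid_cells[of n W] by (auto simp: C_def)
    then have fin: "finite (grid_round n ` \<Union>S)"
      using finite_grid_round_image[OF W(2), of n] by (meson finite_subset image_mono)
    show ?thesis
      using max_colorable_insert_le[OF fin, of k _ p]
        max_colorable_mono[of "insert p (grid_round n ` \<Union>S)" "grid_round n ` \<Union>S" k] fin
      unfolding f_def grid_colorable_def eq
      by (smt (verit) finite.insertI of_nat_1 of_nat_add of_nat_mono subset_insertI)
  qed
  then have "bernoulli_expect C (hit_prob l) (\<lambda>S. (f S)\<^sup>2) - (bernoulli_expect C (hit_prob l) f)\<^sup>2
      \<le> (\<Sum>c\<in>C. hit_prob l c)"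
    using C hit_prob_bounds by (intro bernoulli_variance_le) (auto simp: cell_family_def)
  moreover have "expectation (\<lambda>\<omega>. (f (occupied (X \<omega>) C))\<^sup>2) = bernoulli_expect C (hit_prob l) (\<lambda>S. (f S)\<^sup>2)"
    using occupied_expectation[OF C] by (rule has_bochner_integral_integral_eq)
  moreover have "expectation (\<lambda>\<omega>. f (occupied (X \<omega>) C)) = bernoulli_expect C (hit_prob l) f"
    using occupied_expectation[OF C] by (rule has_bochner_integral_integral_eq)
  ultimately show ?thesis
    using sum_hit_prob_grid_cells[of n] unfolding f[symmetric] C_def[symmetric] by simp
qed

text \<open>First and second moments of the discretised numbers converge by bounded convergence, and
  their variance bound is uniform in \<open>n\<close>.\<close>

lemma variance_max_colorable_le:
  "variance (\<lambda>\<omega>. real (max_colorable k 1 (W \<inter> X \<omega>))) \<le> l * measure lborel W"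
proof -
  define N where "N \<omega> = real (max_colorable k 1 (W \<inter> X \<omega>))" for \<omega>
  define N' where "N' n \<omega> = grid_colorable k n (W \<inter> X \<omega>)" for n \<omega>
  obtain K where K: "\<And>n \<omega>. \<omega> \<in> space M \<Longrightarrow> \<bar>N' n \<omega>\<bar> \<le> K"
    by (rule bounded_max_colorable, rule that) (simp add: N'_def)
  have lim: "(\<lambda>n. N' n \<omega>) \<longlonglongrightarrow> N \<omega>" if "\<omega> \<in> space M" for \<omega>
    unfolding N'_def N_def using that by (rule grid_colorable_tendsto)
  have meas: "N' n \<in> borel_measurable M" for n
    unfolding N'_def by (rule grid_colorable_measurable)
  have "(\<lambda>n. expectation (N' n)) \<longlonglongrightarrow> expectation N"
    using meas lim K by (rule bounded_convergence)
  moreover have "(\<lambda>n. expectation (\<lambda>\<omega>. (N' n \<omega>)\<^sup>2)) \<longlonglongrightarrow> expectation (\<lambda>\<omega>. (N \<omega>)\<^sup>2)"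
  proof (rule bounded_convergence)
    show "(\<lambda>\<omega>. (N' n \<omega>)\<^sup>2) \<in> borel_measurable M" for n using meas by measurable
    show "(\<lambda>n. (N' n \<omega>)\<^sup>2) \<longlonglongrightarrow> (N \<omega>)\<^sup>2" if "\<omega> \<in> space M" for \<omega>
      using lim[OF that] by (intro tendsto_intros)
    show "\<bar>(N' n \<omega>)\<^sup>2\<bar> \<le> K\<^sup>2" if "\<omega> \<in> space M" for n \<omega>
      using power_mono[OF K[OF that, of n], of 2] by simp
  qed
  ultimately have "(\<lambda>n. expectation (\<lambda>\<omega>. (N' n \<omega>)\<^sup>2) - (expectation (N' n))\<^sup>2)
      \<longlonglongrightarrow> expectation (\<lambda>\<omega>. (N \<omega>)\<^sup>2) - (expectation N)\<^sup>2"
    by (intro tendsto_intros)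
  moreover have "expectation (\<lambda>\<omega>. (N' n \<omega>)\<^sup>2) - (expectation (N' n))\<^sup>2 \<le> l * measure lborel W" for n
    unfolding N'_def[abs_def] by (rule variance_grid_colorable_le)
  ultimately have "expectation (\<lambda>\<omega>. (N \<omega>)\<^sup>2) - (expectation N)\<^sup>2 \<le> l * measure lborel W"
    by (blast intro: LIMSEQ_le_const2)
  moreover have "variance N = expectation (\<lambda>\<omega>. (N \<omega>)\<^sup>2) - (expectation N)\<^sup>2"
    using bounded_rv_max_colorable unfolding N_def
    by (intro variance_eq bounded_rv_integrable) (auto simp: power2_eq_square intro: bounded_rv_mult)
  ultimately show ?thesis unfolding N_def[symmetric] by simp
qed

end

end

section \<open>Scores and the lower variance bound\<close>

context poisson_point_process
begin

text \<open>With \<open>A\<close> surrounding \<open>b\<close>, the score detects whether \<open>b\<close> contributes to the colouring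
  on the event that the moat \<open>A\<close> is empty.\<close>

definition score :: "'a set \<Rightarrow> 'a set \<Rightarrow> 'w \<Rightarrow> real" where
  "score A b \<omega> = of_bool (A \<inter> X \<omega> = {}) * (of_bool (b \<inter> X \<omega> \<noteq> {}) - hit_prob l b)"

lemma of_bool_hit_measurable:
  assumes "c \<in> sets borel" "bounded c"
  shows "(\<lambda>\<omega>. of_bool (c \<inter> X \<omega> \<noteq> {}) :: real) \<in> borel_measurable M"
    "(\<lambda>\<omega>. of_bool (c \<inter> X \<omega> = {}) :: real) \<in> borel_measurable M"
proof -
  have c: "cell_family {c}" using assms by (simp add: cell_family_def)
  have eq: "c \<in> occupied (X \<omega>) {c} \<longleftrightarrow> c \<inter> X \<omega> \<noteq> {}" for \<omega>
    by (auto simp: occupied_def)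
  show "(\<lambda>\<omega>. of_bool (c \<inter> X \<omega> \<noteq> {}) :: real) \<in> borel_measurable M"
    using occupied_measurable[OF c, of "\<lambda>S. of_bool (c \<in> S)"] unfolding eq .
  show "(\<lambda>\<omega>. of_bool (c \<inter> X \<omega> = {}) :: real) \<in> borel_measurable M"
    using occupied_measurable[OF c, of "\<lambda>S. of_bool (\<not> c \<in> S)"] unfolding eq by simp
qed

lemma bounded_rv_of_bool_hit:
  assumes "c \<in> sets borel" "bounded c"
  shows "bounded_rv (\<lambda>\<omega>. of_bool (c \<inter> X \<omega> \<noteq> {}))" "bounded_rv (\<lambda>\<omega>. of_bool (c \<inter> X \<omega> = {}))"
  unfolding bounded_rv_def using of_bool_hit_measurable[OF assms] by (auto intro!: exI[of _ 1])

context
  fixes A b :: "'a set"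
  assumes A: "A \<in> sets borel" "bounded A" "A \<noteq> {}"
    and b: "b \<in> sets borel" "bounded b" "b \<noteq> {}"
    and Ab: "A \<inter> b = {}"
begin

lemma bounded_rv_score: "bounded_rv (score A b)"
  unfolding score_def
  by (intro bounded_rv_mult bounded_rv_diff bounded_rv_const bounded_rv_of_bool_hit A b)

lemma cell_family_pair: "cell_family {b, A}"
  using A b Ab by (auto simp: cell_family_def disjoint_def)

lemma pair_distinct: "b \<noteq> A"
  using A b Ab by auto

text \<open>The centred hit of \<open>b\<close> is independent of the event that the moat is
  empty.\<close>

lemma expectation_score: "expectation (score A b) = 0"
proof -
  have "has_bochner_integral M (\<lambda>\<omega>. of_bool (A \<notin> occupied (X \<omega>) {A}) *
      (of_bool (b \<inter> X \<omega> \<noteq> {}) - hit_prob l b)) 0"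
    using centred_hit_uncorrelated[of b "{A}" "\<lambda>S. of_bool (A \<notin> S)"] cell_family_pair pair_distinct by simp
  moreover have "A \<notin> occupied (X \<omega>) {A} \<longleftrightarrow> A \<inter> X \<omega> = {}" for \<omega>
    by (auto simp: occupied_def)
  ultimately show ?thesis
    unfolding score_def[abs_def] by (auto dest: has_bochner_integral_integral_eq)
qed

text \<open>The probability of an empty moat times the variance of a Bernoulli bit with parameter
  \<open>hit_prob l b\<close>.\<close>

lemma expectation_score_square:
  "expectation (\<lambda>\<omega>. score A b \<omega> * score A b \<omega>) =
    (1 - hit_prob l A) * hit_prob l b * (1 - hit_prob l b)"
proof -
  define f :: "'a set set \<Rightarrow> real" where "f S = (of_bool (A \<notin> S) * (of_bool (b \<in> S) - hit_prob l b))\<^sup>2" for S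
  have f: "f (occupied (X \<omega>) {b, A}) = score A b \<omega> * score A b \<omega>" for \<omega>
    unfolding f_def score_def power2_eq_square by (auto simp: occupied_def)
  have "expectation (\<lambda>\<omega>. f (occupied (X \<omega>) {b, A})) = bernoulli_expect {b, A} (hit_prob l) f"
    using occupied_expectation[OF cell_family_pair] by (rule has_bochner_integral_integral_eq)
  also have "\<dots> = (1 - hit_prob l A) * hit_prob l b * (1 - hit_prob l b)"
    using pair_distinct by (simp add: bernoulli_expect_insert f_def power2_eq_square algebra_simps)
  finally show ?thesis by (simp add: f)
qed

lemma expectation_moat_empty_hit:
  "expectation (\<lambda>\<omega>. of_bool (A \<inter> X \<omega> = {}) * of_bool (b \<inter> X \<omega> \<noteq> {})) =
    (1 - hit_prob l A) * hit_prob l b"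
proof -
  define f :: "'a set set \<Rightarrow> real" where "f S = of_bool (A \<notin> S) * of_bool (b \<in> S)" for S
  have f: "f (occupied (X \<omega>) {b, A}) = of_bool (A \<inter> X \<omega> = {}) * of_bool (b \<inter> X \<omega> \<noteq> {})" for \<omega>
    unfolding f_def by (auto simp: occupied_def)
  have "expectation (\<lambda>\<omega>. f (occupied (X \<omega>) {b, A})) = bernoulli_expect {b, A} (hit_prob l) f"
    using occupied_expectation[OF cell_family_pair] by (rule has_bochner_integral_integral_eq)
  also have "\<dots> = (1 - hit_prob l A) * hit_prob l b"
    using pair_distinct by (simp add: bernoulli_expect_insert f_def algebra_simps)
  finally show ?thesis by (simp only: f)
qed

text \<open>The score is uncorrelated with any function of the occupancy of cells in
  \<open>V\<close>. The colouring number itself is only a limit of such functions, so the identity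
  is shown for each grid and passed to the limit.\<close>

lemma score_uncorrelated_outside:
  assumes V: "V \<in> sets borel" "bounded V" "V \<inter> A = {}" "V \<inter> b = {}"
  shows "expectation (\<lambda>\<omega>. real (max_colorable k 1 (V \<inter> X \<omega>)) * score A b \<omega>) = 0"
proof -
  define s where "s n \<omega> = grid_colorable k n (V \<inter> X \<omega>) * score A b \<omega>" for n \<omega>
  have "expectation (s n) = 0" for n
  proof -
    define C where "C = insert A (grid_cells n V)"
    \<comment> \<open>The pattern includes the bit of \<open>A\<close>; it is removed for the
      colouring number and used for the moat indicator.\<close>
    define f where "f S = grid_colorable k n (\<Union>(S - {A})) * of_bool (A \<notin> S)" for S
    have sub: "c \<subseteq> V" if "c \<in> grid_cells n V" for c
      using that Union_grid_cells[of n V] by blast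
    \<comment> \<open>Grid cells are nonempty subsets of \<open>V\<close>, while \<open>A\<close>
      and \<open>b\<close> are disjoint from \<open>V\<close>.\<close>
    have notin: "A \<notin> grid_cells n V" "b \<notin> C"
      using sub grid_cells_nonempty[of n V] V(3,4) A(3) b(3) pair_distinct unfolding C_def by blast+
    have "cell_family (insert b C)"
    proof -
      have "disjnt A c" "disjnt c A" "disjnt b c" "disjnt c b" if "c \<in> grid_cells n V" for c
        using sub[OF that] V(3,4) unfolding disjnt_def by blast+
      moreover have "disjnt A b" "disjnt b A" using Ab by (auto simp: disjnt_def)
      ultimately show ?thesis
        using cell_family_grid_cells[OF V(1,2), of n] A(1,2) b(1,2)
        unfolding cell_family_def C_def by (auto simp: pairwise_insert)
    qed
    then have "has_bochner_integral M
        (\<lambda>\<omega>. f (occupied (X \<omega>) C) * (of_bool (b \<inter> X \<omega> \<noteq> {}) - hit_prob l b)) 0"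
      using notin(2) by (rule centred_hit_uncorrelated)
    moreover have "f (occupied (X \<omega>) C) = grid_colorable k n (V \<inter> X \<omega>) * of_bool (A \<inter> X \<omega> = {})" for \<omega>
    proof -
      have "occupied (X \<omega>) C - {A} = occupied (X \<omega>) (grid_cells n V)"
        using notin(1) by (auto simp: occupied_def C_def)
      moreover have "A \<in> occupied (X \<omega>) C \<longleftrightarrow> A \<inter> X \<omega> \<noteq> {}"
        by (simp add: occupied_def C_def)
      ultimately show ?thesis by (simp add: f_def grid_colorable_occupied)
    qed
    ultimately show ?thesis
      unfolding s_def[abs_def] score_def by (auto dest: has_bochner_integral_integral_eq simp: mult.assoc)
  qed
  moreover have "(\<lambda>n. expectation (s n)) \<longlonglongrightarrow>
      expectation (\<lambda>\<omega>. real (max_colorable k 1 (V \<inter> X \<omega>)) * score A b \<omega>)"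
  proof -
    obtain K where K: "\<And>n \<omega>. \<omega> \<in> space M \<Longrightarrow> \<bar>grid_colorable k n (V \<inter> X \<omega>)\<bar> \<le> K"
      by (rule bounded_max_colorable[OF V(1,2), where k = k]) (blast intro: that)
    obtain K' where K': "\<And>\<omega>. \<omega> \<in> space M \<Longrightarrow> \<bar>score A b \<omega>\<bar> \<le> K'"
      using bounded_rv_score by (auto simp: bounded_rv_def)
    show ?thesis
    proof (rule bounded_convergence)
      show "s n \<in> borel_measurable M" for n
        unfolding s_def using grid_colorable_measurable[OF V(1,2)] bounded_rv_score
        by (intro borel_measurable_times) (auto simp: bounded_rv_def)
      show "(\<lambda>n. s n \<omega>) \<longlonglongrightarrow> real (max_colorable k 1 (V \<inter> X \<omega>)) * score A b \<omega>"
        if "\<omega> \<in> space M" for \<omega>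
        unfolding s_def by (intro tendsto_intros grid_colorable_tendsto V that)
      show "\<bar>s n \<omega>\<bar> \<le> K * K'" if "\<omega> \<in> space M" for n \<omega>
        unfolding s_def abs_mult using K[OF that, of n] K'[OF that] by (intro mult_mono) linarith+
    qed
  qed
  ultimately show ?thesis
    by (simp add: LIMSEQ_const_iff)
qed

text \<open>When the moat is empty, the number splits into that of \<open>V\<close>, which is
  uncorrelated with the score, and that of \<open>b\<close>, which is 0 if \<open>b\<close> is empty
  and at least 1 otherwise. The resulting bound equals the variance of the score.\<close>

lemma score_correlation_ge:
  assumes V: "V \<in> sets borel" "bounded V" "V \<inter> A = {}" "V \<inter> b = {}"
    and far: "\<And>u v. u \<in> V \<Longrightarrow> v \<in> b \<Longrightarrow> norm (u - v) > 1" and k: "k \<ge> 1"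
  shows "expectation (\<lambda>\<omega>. real (max_colorable k 1 ((V \<union> A \<union> b) \<inter> X \<omega>)) * score A b \<omega>)
    \<ge> (1 - hit_prob l A) * hit_prob l b * (1 - hit_prob l b)"
proof -
  define q where "q = hit_prob l b"
  have q: "0 \<le> q" "q \<le> 1" using hit_prob_bounds by (auto simp: q_def)
  define N where "N B \<omega> = real (max_colorable k 1 (B \<inter> X \<omega>))" for B \<omega>
  have NV: "bounded_rv (N V)" and N: "bounded_rv (N (V \<union> A \<union> b))"
    unfolding N_def using V A b by (auto intro!: bounded_rv_max_colorable)
  define e :: "'w \<Rightarrow> real" where "e \<omega> = of_bool (A \<inter> X \<omega> = {}) * of_bool (b \<inter> X \<omega> \<noteq> {})" for \<omega>
  have e: "bounded_rv e"
    unfolding e_def by (intro bounded_rv_mult bounded_rv_of_bool_hit A b)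
  \<comment> \<open>When the moat is occupied, the score and \<open>e\<close> vanish and both sides
    are 0.\<close>
  have "N V \<omega> * score A b \<omega> + (1 - q) * e \<omega> \<le> N (V \<union> A \<union> b) \<omega> * score A b \<omega>" if "\<omega> \<in> space M" for \<omega>
  proof (cases "A \<inter> X \<omega> = {}")
    case True
    have fin: "finite (V \<inter> X \<omega>)" "finite (b \<inter> X \<omega>)"
      using finite_window that V b by auto
    have "(V \<union> A \<union> b) \<inter> X \<omega> = (V \<inter> X \<omega>) \<union> (b \<inter> X \<omega>)" using True by blast
    moreover have "max_colorable k 1 ((V \<inter> X \<omega>) \<union> (b \<inter> X \<omega>)) =
        max_colorable k 1 (V \<inter> X \<omega>) + max_colorable k 1 (b \<inter> X \<omega>)"
      by (rule max_colorable_Un_far) (use far fin in auto)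
    ultimately have eq: "N (V \<union> A \<union> b) \<omega> = N V \<omega> + N b \<omega>"
      by (simp add: N_def)
    have "e \<omega> * (1 - q) \<le> N b \<omega> * score A b \<omega>"
    proof (cases "b \<inter> X \<omega> = {}")
      case True
      then have "N b \<omega> = 0"
        using max_colorable_le_cover[of "{}" "{}" "\<lambda>_. {}" 1 k] by (simp add: N_def)
      then show ?thesis using True by (simp add: e_def)
    next
      case False
      then have "1 \<le> N b \<omega>" using max_colorable_ge_1[OF fin(2)] k by (simp add: N_def)
      then have "1 * (1 - q) \<le> N b \<omega> * (1 - q)" using q by (intro mult_right_mono) auto
      then show ?thesis
        using False \<open>A \<inter> X \<omega> = {}\<close> by (simp add: e_def score_def q_def)
    qed
    then show ?thesis by (simp add: eq algebra_simps)
  next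
    case False
    then show ?thesis by (simp add: e_def score_def)
  qed
  then have "expectation (\<lambda>\<omega>. N V \<omega> * score A b \<omega> + (1 - q) * e \<omega>) \<le>
      expectation (\<lambda>\<omega>. N (V \<union> A \<union> b) \<omega> * score A b \<omega>)"
    by (intro integral_mono bounded_rv_integrable bounded_rv_add bounded_rv_mult bounded_rv_const
        NV N e bounded_rv_score)
  moreover have "expectation (\<lambda>\<omega>. N V \<omega> * score A b \<omega> + (1 - q) * e \<omega>) =
      expectation (\<lambda>\<omega>. N V \<omega> * score A b \<omega>) + (1 - q) * expectation e"
    using bounded_rv_integrable[OF bounded_rv_mult[OF NV bounded_rv_score]] bounded_rv_integrable[OF e] by simp
  moreover have "expectation (\<lambda>\<omega>. N V \<omega> * score A b \<omega>) = 0"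
    unfolding N_def by (rule score_uncorrelated_outside[OF V])
  moreover have "expectation e = (1 - hit_prob l A) * q"
    unfolding e_def[abs_def] q_def by (rule expectation_moat_empty_hit)
  ultimately show ?thesis by (simp add: N_def q_def algebra_simps)
qed

end

text \<open>The centred hit of \<open>b'\<close> is independent of the other three bits. The
  cardinality condition states that the four cells are pairwise distinct.\<close>

lemma expectation_score_mult:
  assumes C: "cell_family {A, b, A', b'}" and dist: "card {A, b, A', b'} = 4"
  shows "expectation (\<lambda>\<omega>. score A b \<omega> * score A' b' \<omega>) = 0"
proof -
  have b': "b' \<notin> {A, b, A'}"
    using dist by (auto simp: card_insert_if split: if_splits)
  define f where "f S = (of_bool (A \<notin> S) * (of_bool (b \<in> S) - hit_prob l b)) * of_bool (A' \<notin> S)" for S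
  have f: "f (occupied (X \<omega>) {A, b, A'}) = score A b \<omega> * of_bool (A' \<inter> X \<omega> = {})" for \<omega>
    unfolding f_def score_def by (auto simp: occupied_def)
  have "insert b' {A, b, A'} = {A, b, A', b'}" by auto
  then have "has_bochner_integral M (\<lambda>\<omega>. f (occupied (X \<omega>) {A, b, A'}) *
      (of_bool (b' \<inter> X \<omega> \<noteq> {}) - hit_prob l b')) 0"
    using C b' by (intro centred_hit_uncorrelated) simp_all
  then show ?thesis
    unfolding f score_def[of A'] by (auto dest: has_bochner_integral_integral_eq simp: mult.assoc)
qed

text \<open>The scores of disjoint cubes form an orthogonal family; equal volumes \<open>mA\<close>
  and \<open>mb\<close> give them a common variance, which also bounds their correlation with the
  colouring number from below.\<close>

lemma variance_max_colorable_ge: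
  assumes W: "W \<in> sets borel" "bounded W" and "finite I" and k: "k \<ge> 1"
    and A: "\<And>i. i \<in> I \<Longrightarrow> A i \<in> sets borel \<and> A i \<noteq> {} \<and> A i \<subseteq> W \<and> measure lborel (A i) = mA"
    and b: "\<And>i. i \<in> I \<Longrightarrow> b i \<in> sets borel \<and> b i \<noteq> {} \<and> b i \<subseteq> W \<and> measure lborel (b i) = mb"
    and Ab: "\<And>i. i \<in> I \<Longrightarrow> A i \<inter> b i = {}"
    and disj: "\<And>i j. i \<in> I \<Longrightarrow> j \<in> I \<Longrightarrow> i \<noteq> j \<Longrightarrow> (A i \<union> b i) \<inter> (A j \<union> b j) = {}"
    and far: "\<And>i u v. i \<in> I \<Longrightarrow> u \<notin> A i \<union> b i \<Longrightarrow> v \<in> b i \<Longrightarrow> norm (u - v) > 1"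
  shows "variance (\<lambda>\<omega>. real (max_colorable k 1 (W \<inter> X \<omega>))) \<ge>
    real (card I) * (exp (- (l * mA)) * (1 - exp (- (l * mb))) * exp (- (l * mb)))"
proof (rule variance_ge_orthogonal[where h = "\<lambda>i. score (A i) (b i)"])
  have bdd: "bounded (A i)" "bounded (b i)" if "i \<in> I" for i
    using A[OF that] b[OF that] W(2) bounded_subset by blast+
  have hyps: "A i \<in> sets borel" "bounded (A i)" "A i \<noteq> {}" "b i \<in> sets borel" "bounded (b i)" "b i \<noteq> {}"
      "A i \<inter> b i = {}" if "i \<in> I" for i
    using A b Ab bdd that by auto
  have v: "exp (- (l * mA)) * (1 - exp (- (l * mb))) * exp (- (l * mb)) =
      (1 - hit_prob l (A i)) * hit_prob l (b i) * (1 - hit_prob l (b i))" if "i \<in> I" for i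
    using A[OF that] b[OF that] by (simp add: hit_prob_def)
  show "bounded_rv (\<lambda>\<omega>. real (max_colorable k 1 (W \<inter> X \<omega>)))"
    by (rule bounded_rv_max_colorable[OF W])
  show "finite I" by fact
  fix i assume i: "i \<in> I"
  show "bounded_rv (score (A i) (b i))" by (rule bounded_rv_score[OF hyps[OF i]])
  show "expectation (score (A i) (b i)) = 0" by (rule expectation_score[OF hyps[OF i]])
  have "W = (W - (A i \<union> b i)) \<union> A i \<union> b i" using A[OF i] b[OF i] by blast
  moreover have "expectation (\<lambda>\<omega>. real (max_colorable k 1 (((W - (A i \<union> b i)) \<union> A i \<union> b i) \<inter> X \<omega>))
      * score (A i) (b i) \<omega>) \<ge> (1 - hit_prob l (A i)) * hit_prob l (b i) * (1 - hit_prob l (b i))"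
    using W hyps[OF i] far[OF i] k
    by (intro score_correlation_ge[OF hyps[OF i]]) (auto intro: bounded_subset)
  ultimately show "expectation (\<lambda>\<omega>. real (max_colorable k 1 (W \<inter> X \<omega>)) * score (A i) (b i) \<omega>) \<ge>
      exp (- (l * mA)) * (1 - exp (- (l * mb))) * exp (- (l * mb))"
    using v[OF i] by simp
  fix j assume j: "j \<in> I"
  show "expectation (\<lambda>\<omega>. score (A i) (b i) \<omega> * score (A j) (b j) \<omega>) =
      (if i = j then exp (- (l * mA)) * (1 - exp (- (l * mb))) * exp (- (l * mb)) else 0)"
  proof (cases "i = j")
    case True
    then show ?thesis using expectation_score_square[OF hyps[OF i]] v[OF i] by simp
  next
    case False
    have d: "A i \<inter> A j = {}" "A i \<inter> b j = {}" "b i \<inter> A j = {}" "b i \<inter> b j = {}"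
      using disj[OF i j False] by blast+
    have "cell_family {A i, b i, A j, b j}"
      using hyps[OF i] hyps[OF j] d unfolding cell_family_def disjoint_def by (simp add: Int_commute)
    moreover have "card {A i, b i, A j, b j} = 4"
    proof -
      have "A i \<noteq> b i" "A i \<noteq> A j" "A i \<noteq> b j" "b i \<noteq> A j" "b i \<noteq> b j" "A j \<noteq> b j"
        using hyps[OF i] hyps[OF j] d by auto
      then show ?thesis by simp
    qed
    ultimately show ?thesis using expectation_score_mult False by simp
  qed
qed

end

section \<open>The lattice of cubes with cores\<close>

lemma measure_cube_cart:
  fixes a :: "real ^ 'n"
  assumes "0 \<le> s"
  shows "measure lborel (cbox a (\<chi> i. a $ i + s)) = s ^ CARD('n)"
proof -
  have "cbox a (\<chi> i. a $ i + s) \<noteq> {}"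
    using assms by (auto simp: interval_ne_empty_cart)
  then show ?thesis by (simp add: content_cbox_cart)
qed

text \<open>Side 4 with period 5 leaves gaps of width 1, so that even the closed cubes are
  disjoint.\<close>

definition cube :: "('n::finite \<Rightarrow> nat) \<Rightarrow> (real ^ 'n) set" where
  "cube z = {x. \<forall>i. 5 * real (z i) \<le> x $ i \<and> x $ i \<le> 5 * real (z i) + 4}"

text \<open>The centred unit cube: its margin of 3/2 to every face of the cube exceeds the
  connection radius 1.\<close>

definition core :: "('n::finite \<Rightarrow> nat) \<Rightarrow> (real ^ 'n) set" where
  "core z = {x. \<forall>i. 5 * real (z i) + 3/2 \<le> x $ i \<and> x $ i \<le> 5 * real (z i) + 5/2}"

text \<open>The nested upper corner has the shape required by
  \<open>measure_cube_cart\<close>.\<close>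

lemma cube_cbox: "cube z = cbox (\<chi> i. 5 * real (z i)) (\<chi> i. (\<chi> i. 5 * real (z i)) $ i + 4)"
  by (auto simp: cube_def mem_box_cart)

lemma core_cbox:
  "core z = cbox (\<chi> i. 5 * real (z i) + 3/2) (\<chi> i. (\<chi> i. 5 * real (z i) + 3/2) $ i + 1)"
  by (auto simp: core_def mem_box_cart add.commute)

lemma cube_core_basic:
  "cube z \<in> sets borel" "core z \<in> sets borel" "core z \<subseteq> cube z" "core z \<noteq> {}" "cube z - core z \<noteq> {}"
  "measure lborel (core (z :: 'n::finite \<Rightarrow> nat)) = 1"
  "measure lborel (cube z - core z) = 4 ^ CARD('n) - 1"
proof -
  show borel: "cube z \<in> sets borel" "core z \<in> sets borel"
    unfolding cube_cbox core_cbox by simp_all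
  show sub: "core z \<subseteq> cube z"
  proof
    fix x assume "x \<in> core z"
    then have "5 * real (z i) + 3/2 \<le> x $ i" "x $ i \<le> 5 * real (z i) + 5/2" for i
      by (auto simp: core_def)
    then have "5 * real (z i) \<le> x $ i \<and> x $ i \<le> 5 * real (z i) + 4" for i
      by (smt (verit) field_sum_of_halves)
    then show "x \<in> cube z" by (simp add: cube_def)
  qed
  have "(\<chi> i. 5 * real (z i) + 2) \<in> core z" by (simp add: core_def)
  then show "core z \<noteq> {}" by blast
  \<comment> \<open>Offset 1 lies in the side \<open>[0, 4]\<close> of the cube but below the side
    \<open>[3/2, 5/2]\<close> of the core.\<close>
  have "(\<chi> i. 5 * real (z i) + 1) \<in> cube z - core z" by (simp add: core_def cube_def)
  then show "cube z - core z \<noteq> {}" by blast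
  show core: "measure lborel (core z) = 1"
    unfolding core_cbox by (subst measure_cube_cart) simp_all
  have cube: "measure lborel (cube z) = 4 ^ CARD('n)"
    unfolding cube_cbox by (subst measure_cube_cart) simp_all
  have "emeasure lborel (cube z) \<noteq> \<infinity>"
    unfolding cube_cbox by (metis emeasure_lborel_cbox_finite infinity_ennreal_def order_less_irrefl)
  then show "measure lborel (cube z - core z) = 4 ^ CARD('n) - 1"
    using measure_Diff[of lborel "cube z" "core z"] borel sub core cube by simp
qed

lemma cube_disjoint:
  assumes "z \<noteq> z'"
  shows "cube z \<inter> cube z' = {}"
proof -
  obtain i where "z i \<noteq> z' i" using assms by blast
  then have "real (z i) + 1 \<le> real (z' i) \<or> real (z' i) + 1 \<le> real (z i)" by linarith
  then have False if "x \<in> cube z" "x \<in> cube z'" for x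
  proof -
    have "5 * real (z i) \<le> x $ i" "x $ i \<le> 5 * real (z i) + 4"
        "5 * real (z' i) \<le> x $ i" "x $ i \<le> 5 * real (z' i) + 4"
      using that by (auto simp: cube_def)
    then show False
      using \<open>real (z i) + 1 \<le> real (z' i) \<or> real (z' i) + 1 \<le> real (z i)\<close> by linarith
  qed
  then show ?thesis by blast
qed

text \<open>Some coordinate of \<open>u\<close> leaves the range of the cube, and in that coordinate
  the core keeps a margin of 3/2.\<close>

lemma core_far_from_outside:
  assumes "u \<notin> cube z" "v \<in> core z"
  shows "norm (u - v) > 1"
proof -
  obtain i where "u $ i < 5 * real (z i) \<or> 5 * real (z i) + 4 < u $ i"
    using assms(1) unfolding cube_def by (auto simp: not_le)
  moreover have "5 * real (z i) + 3/2 \<le> v $ i" "v $ i \<le> 5 * real (z i) + 5/2"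
    using assms(2) by (auto simp: core_def)
  ultimately have "1 < \<bar>(u - v) $ i\<bar>" by (auto simp: abs_if)
  then show ?thesis using component_le_norm_cart[of "u - v" i] by linarith
qed

section \<open>Both variance bounds for the growing window\<close>

theorem lemma7:
  fixes intensity :: real and k :: nat
  assumes "intensity > 0" and "k \<ge> 1"
  shows "\<exists>c C t\<^sub>0 :: real. 0 < c \<and> c \<le> C \<and> 0 < t\<^sub>0 \<and>
           (\<forall>(M :: 'w measure) (X :: 'w \<Rightarrow> (real ^ 'n) set). poisson_process M intensity X \<longrightarrow>
              (\<forall>t \<ge> t\<^sub>0. c * t ^ CARD('n) \<le> sigma_squared M k X t \<and>
                       sigma_squared M k X t \<le> C * t ^ CARD('n)))"
proof -
  define d where "d = CARD('n)"
  \<comment> \<open>The common variance of the scores, for moat volume \<open>4 ^ d - 1\<close> and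
    core volume 1.\<close>
  define v where "v = exp (- (intensity * (4 ^ d - 1))) * (1 - exp (- (intensity * 1))) * exp (- (intensity * 1))"
  have v: "v > 0" unfolding v_def using assms(1) by simp
  have bounds: "v / 10 ^ d * t ^ d \<le> sigma_squared M k X t \<and> sigma_squared M k X t \<le> intensity * t ^ d"
    if pp: "poisson_process M intensity X" and t: "t \<ge> 5"
    for M :: "'w measure" and X :: "'w \<Rightarrow> (real ^ 'n) set" and t
  proof -
    interpret prob_space M using pp by (simp add: poisson_process_def)
    interpret poisson_point_process M intensity X
      by unfold_locales (use pp assms in auto)
    define W where "W = cbox 0 (vec t :: real ^ 'n)"
    have W: "W \<in> sets borel" "bounded W" by (auto simp: W_def bounded_cbox)
    have sigma: "sigma_squared M k X t = variance (\<lambda>\<omega>. real (max_colorable k 1 (W \<inter> X \<omega>)))"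
      by (simp add: sigma_squared_def F_def[abs_def] W_def)
    have "measure lborel W = t ^ d"
      using measure_cube_cart[of t "0 :: real ^ 'n"] t by (simp add: W_def d_def vec_def)
    then have upper: "sigma_squared M k X t \<le> intensity * t ^ d"
      using variance_max_colorable_le[OF W, of k] sigma by simp
    \<comment> \<open>The number of lattice cubes along each axis that fit into the window;
      \<open>t \<ge> 5\<close> guarantees at least one.\<close>
    define m where "m = nat \<lfloor>t / 5\<rfloor>"
    have "1 \<le> \<lfloor>t / 5\<rfloor>" using t by (simp add: le_floor_iff)
    then have "real m = of_int \<lfloor>t / 5\<rfloor>" "1 \<le> real m" by (simp_all add: m_def)
    \<comment> \<open>Adding \<open>1 \<le> m\<close> and \<open>t / 5 < m + 1\<close> gives
      \<open>t / 5 < 2 * m\<close>, the origin of the factor 10.\<close>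
    then have m: "5 * real m \<le> t" "t / 10 \<le> real m"
      using of_int_floor_le[of "t / 5"] real_of_int_floor_add_one_gt[of "t / 5"] by linarith+
    define I where "I = (PiE UNIV (\<lambda>_. {..<m}) :: ('n \<Rightarrow> nat) set)"
    have I: "finite I" "card I = m ^ d"
      by (auto simp: I_def d_def card_PiE intro: finite_PiE)
    have sub: "cube z \<subseteq> W" if "z \<in> I" for z
    proof
      fix x assume x: "x \<in> cube z"
      have "0 \<le> x $ i \<and> x $ i \<le> t" for i
      proof -
        have "z i < m" using that by (auto simp: I_def PiE_def Pi_def)
        then have "real (z i) + 1 \<le> real m" by linarith
        moreover have "5 * real (z i) \<le> x $ i" "x $ i \<le> 5 * real (z i) + 4"
          using x by (auto simp: cube_def)
        ultimately show ?thesis using m(1) by linarith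
      qed
      then show "x \<in> W" by (simp add: W_def mem_box_cart)
    qed
    have cup: "(cube z - core z) \<union> core z = cube z" for z :: "'n \<Rightarrow> nat"
      using cube_core_basic(3)[of z] by blast
    have "variance (\<lambda>\<omega>. real (max_colorable k 1 (W \<inter> X \<omega>))) \<ge> real (card I) * v"
      unfolding v_def d_def
    proof (rule variance_max_colorable_ge[OF W I(1) assms(2), where A = "\<lambda>z. cube z - core z" and b = core])
      fix z assume z: "z \<in> I"
      show "cube z - core z \<in> sets borel \<and> cube z - core z \<noteq> {} \<and> cube z - core z \<subseteq> W \<and>
          measure lborel (cube z - core z) = 4 ^ CARD('n) - 1"
        using cube_core_basic[of z] sub[OF z] by blast
      show "core z \<in> sets borel \<and> core z \<noteq> {} \<and> core z \<subseteq> W \<and> measure lborel (core z) = 1"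
        using cube_core_basic[of z] sub[OF z] by blast
      show "(cube z - core z) \<inter> core z = {}" by blast
      show "(cube z - core z \<union> core z) \<inter> (cube z' - core z' \<union> core z') = {}" if "z' \<in> I" "z \<noteq> z'" for z'
        unfolding cup using that(2) by (rule cube_disjoint)
      show "norm (x - y) > 1" if "x \<notin> cube z - core z \<union> core z" "y \<in> core z" for x y
        using that unfolding cup by (rule core_far_from_outside)
    qed
    moreover have "v / 10 ^ d * t ^ d \<le> real (card I) * v"
    proof -
      have "(t / 10) ^ d \<le> real m ^ d" using m(2) t by (intro power_mono) auto
      then have "v * (t / 10) ^ d \<le> v * real m ^ d" using v by (intro mult_left_mono) auto
      then show ?thesis by (simp add: I(2) power_divide mult.commute)
    qed
    ultimately show ?thesis using upper sigma by linarith
  qed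
  have "0 < v / 10 ^ d" using v by simp
  \<comment> \<open>The maximum in the upper constant ensures \<open>c \<le> C\<close>.\<close>
  show ?thesis
  proof (rule exI[of _ "v / 10 ^ d"], rule exI[of _ "max (v / 10 ^ d) intensity"],
      rule exI[of _ "5::real"], intro conjI allI impI)
    fix M :: "'w measure" and X :: "'w \<Rightarrow> (real ^ 'n) set" and t :: real
    assume *: "poisson_process M intensity X" "5 \<le> t"
    show "v / 10 ^ d * t ^ CARD('n) \<le> sigma_squared M k X t"
      using bounds[OF *] by (simp add: d_def)
    have "intensity * t ^ d \<le> max (v / 10 ^ d) intensity * t ^ d"
      using * by (intro mult_right_mono) auto
    then show "sigma_squared M k X t \<le> max (v / 10 ^ d) intensity * t ^ CARD('n)"
      using bounds[OF *] by (simp add: d_def)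
  qed (use \<open>0 < v / 10 ^ d\<close> in auto)
qed

end
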